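(* Let $\bar\sigma\in(-d,1)$ and $\bar r\in[0,+\infty)$. Let $\{\sigma_n\}_{n\in\mathbb{N}}\subset(-d,1)$ and $\{r_n\}_{n\in\mathbb{N}}\subset[0,+\infty)$ be such that $\sigma_n\to\bar\sigma$ and $r_n\to\bar r$ as $n\to+\infty$. Then: (i) ($\Gamma$-liminf inequality) For every $E\in\mathcal{M}_{\mathrm f}(\mathbb{R}^d)$ and every sequence $\{E_n\}_{n\in\mathbb{N}}\subset\mathcal{M}_{\mathrm f}(\mathbb{R}^d)$ with $\chi_{E_n}\to\chi_E$ strongly in $L^1(\mathbb{R}^d)$, $$\hat J^{\bar\sigma}_{\bar r}(E)\le\liminf_{n\to+\infty}\hat J^{\sigma_n}_{r_n}(E_n).$$ (ii) ($\Gamma$-limsup inequality) For every $E\in\mathcal{M}_{\mathrm f}(\mathbb{R}^d)$ there exists a sequence $\{E_n\}_{n\in\mathbb{N}}\subset\mathcal{M}_{\mathrm f}(\mathbb{R}^d)$ such that $\chi_{E_n}\to\chi_E$ strongly in $L^1(\mathbb{R}^d)$ and $$\hat J^{\bar\sigma}_{\bar r}(E)\ge\limsup_{n\to+\infty}\hat J^{\sigma_n}_{r_n}(E_n).$$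
   Context: Let $d\ge1$, let $|E|$ denote Lebesgue measure in $\mathbb{R}^d$, $\omega_d$ the measure of the unit ball, $B_\rho(x)$ the ball of radius $\rho$ and center $x$, and $\chi_E$ the characteristic function of $E$. $\mathcal{M}_{\mathrm f}(\mathbb{R}^d)$ is the family of measurable sets $E\subset\mathbb{R}^d$ with $|E|<+\infty$. For $\sigma\in(-d,1)$ and $r>0$ set $$\gamma^\sigma_r:=d\omega_d\frac{1-r^{-\sigma}}{\sigma}\ \text{ if }\sigma\ne0,\qquad \gamma^0_r:=d\omega_d\log r,$$ $$J^\sigma_r(E):=-\int_E\int_{E\setminus B_r(x)}\frac{1}{|x-y|^{d+\sigma}}\,dy\,dx,\qquad \hat J^\sigma_r(E):=J^\sigma_r(E)-\gamma^\sigma_r|E|,\qquad E\in\mathcal{M}_{\mathrm f}(\mathbb{R}^d).$$ For $r=0$ set $\hat J^\sigma_0:=\hat J^\sigma$, where: - for $\sigma\in(-d,0)$, $\hat J^\sigma(E):=-\int_E\int_E\frac{1}{|x-y|^{d+\sigma}}\,dy\,dx-\frac{d\omega_d}{\sigma}|E|$; - for $\sigma\in[0,1)$, $\hat J^\sigma(E):=\lim_{r\to0^+}\hat J^\sigma_r(E)\in(-\infty,+\infty]$ (the limit exists because $r\mapsto\hat J^\sigma_r(E)$ is non-increasing). *)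

theory Defs
  imports "HOL-Analysis.Analysis"
begin

text \<open>
  The space \<open>\<real>\<^sup>d\<close> is an arbitrary type of class \<open>euclidean_space\<close> with \<open>d = DIM('a)\<close>
  (so \<open>d \<ge> 1\<close> holds automatically); the family of measurable sets of finite
  measure is \<open>lmeasurable\<close>.
\<close>

definition unit_ball_measure :: "'a::euclidean_space itself \<Rightarrow> real" where
  "unit_ball_measure _ = measure lebesgue (ball (0::'a) 1)"

definition gamma_const :: "'a::euclidean_space itself \<Rightarrow> real \<Rightarrow> real \<Rightarrow> real" where
  "gamma_const T \<sigma> r =
     (if \<sigma> \<noteq> 0 then real DIM('a) * unit_ball_measure T * ((1 - r powr (-\<sigma>)) / \<sigma>)
      else real DIM('a) * unit_ball_measure T * ln r)"

text \<open>
  The kernel is nonnegative, so the double integral is taken as an iterated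
  integral in \<open>ennreal\<close>, and the functionals take values in \<open>ereal\<close>. For \<open>r > 0\<close> and
  \<open>E\<close> of finite measure the integral is finite, being at most
  \<open>r powr - (d + \<sigma>) * (measure lebesgue E)\<^sup>2\<close>, so no \<open>\<infinity> - \<infinity>\<close> occurs below.
\<close>

definition J_trunc :: "real \<Rightarrow> real \<Rightarrow> 'a::euclidean_space set \<Rightarrow> ereal" where
  "J_trunc \<sigma> r E =
     - enn2ereal (\<integral>\<^sup>+x\<in>E. (\<integral>\<^sup>+y\<in>E - ball x r.
         ennreal (1 / norm (x - y) powr (real DIM('a) + \<sigma>)) \<partial>lebesgue) \<partial>lebesgue)"

definition J_hat_trunc :: "real \<Rightarrow> real \<Rightarrow> 'a::euclidean_space set \<Rightarrow> ereal" where
  "J_hat_trunc \<sigma> r E =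
     J_trunc \<sigma> r E - ereal (gamma_const TYPE('a) \<sigma> r * measure lebesgue E)"

text \<open>
  On the diagonal the kernel below is \<open>1 / 0 = 0\<close> instead of \<open>\<infinity>\<close>; for each \<open>x\<close> this
  affects only the null set \<open>{x}\<close>. For \<open>\<sigma> < 0\<close> the double integral is finite since
  \<open>d + \<sigma> < d\<close>. For \<open>\<sigma> \<ge> 0\<close> the limit exists because \<open>J_hat_trunc \<sigma> r E\<close> is
  non-increasing in \<open>r\<close>.
\<close>

definition J_hat_zero :: "real \<Rightarrow> 'a::euclidean_space set \<Rightarrow> ereal" where
  "J_hat_zero \<sigma> E =
     (if \<sigma> < 0 then
        - enn2ereal (\<integral>\<^sup>+x\<in>E. (\<integral>\<^sup>+y\<in>E.
            ennreal (1 / norm (x - y) powr (real DIM('a) + \<sigma>)) \<partial>lebesgue) \<partial>lebesgue)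
        - ereal (real DIM('a) * unit_ball_measure TYPE('a) / \<sigma> * measure lebesgue E)
      else Lim (at_right 0) (\<lambda>r. J_hat_trunc \<sigma> r E))"

definition J_hat :: "real \<Rightarrow> real \<Rightarrow> 'a::euclidean_space set \<Rightarrow> ereal" where
  "J_hat \<sigma> r E = (if r = 0 then J_hat_zero \<sigma> E else J_hat_trunc \<sigma> r E)"

definition indicator_L1_tendsto ::
    "(nat \<Rightarrow> 'a::euclidean_space set) \<Rightarrow> 'a set \<Rightarrow> bool" where
  "indicator_L1_tendsto En E \<longleftrightarrow>
     (\<lambda>n. \<integral>x. \<bar>indicat_real (En n) x - indicat_real E x\<bar> \<partial>lebesgue) \<longlonglongrightarrow> 0"

end

theory Submission
  imports Defs
begin

text \<open>
  The mass of the kernel on the shell \<open>{r \<le> |z| < s}\<close> is \<open>\<gamma>\<^sub>s - \<gamma>\<^sub>r\<close>, so that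
  \<open>J\<^sub>r(E) = J\<^sub>s(E) + \<integral>\<^sub>E \<integral>\<^bsub>-E\<^esub> 1\<^bsub>{r \<le> |x - y| < s}\<^esub> |x - y|\<^bsup>-d-\<sigma>\<^esup>\<close> for \<open>0 \<le> r \<le> s\<close>. Hence the functionals decrease
  in \<open>r\<close> and are continuous on \<open>r \<ge> 0\<close>. At a fixed positive radius the kernel
  is bounded and the functional is continuous jointly in \<open>\<sigma>\<close> and \<open>E\<close>. Comparing \<open>r\<^sub>n\<close> with a
  slightly larger fixed radius gives the liminf inequality; comparing with a slightly smaller one
  gives the limsup inequality for constant sequences when the limit radius is positive.

  At limit radius \<open>0\<close> the constant sequence still works if the \<open>\<sigma>'\<close>-perimeter of \<open>E\<close> is finite
  for some \<open>\<sigma>' > \<sigma>\<close>, by dominated convergence. In general \<open>E\<close> is replaced by a superlevel set of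
  \<open>u = \<rho> * \<chi>\<^sub>E\<close>, with \<open>\<rho>\<close> the normalised indicator of a small ball: convexity gives that the
  \<open>\<sigma>\<close>-variation of \<open>u\<close> is at most the \<open>\<sigma>\<close>-perimeter of \<open>E\<close>, the Lipschitz bound on translates of
  \<open>u\<close> in \<open>L\<^sup>1\<close> makes its \<open>\<sigma>'\<close>-variation finite for every \<open>\<sigma>' < 1\<close>, and by the coarea formula some
  superlevel set inherits both bounds. It is close to \<open>E\<close> because for \<open>\<sigma> \<ge> 0\<close> the kernel dominates
  a multiple of \<open>\<rho>\<close>, so that \<open>\<parallel>u - \<chi>\<^sub>E\<parallel>\<close> is bounded by the part of the \<open>\<sigma>\<close>-perimeter coming
  from short distances. A diagonal sequence concludes.
\<close>

section \<open>The kernel and the constant \<open>\<gamma>\<close>\<close>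

text \<open>For \<open>x < 0\<close> the preimage of the ray above \<open>x\<close> under
  \<open>- norm z\<close> is the ball of radius \<open>- x\<close>. The density \<open>?g\<close>
  gives the ray the volume of that ball by the fundamental theorem of calculus, so the two measures
  on the line coincide; reflecting \<open>t\<close> gives the formula.\<close>

lemma nn_integral_norm_polar:
  fixes f :: "real \<Rightarrow> ennreal"
  assumes [measurable]: "f \<in> borel_measurable borel"
  shows "(\<integral>\<^sup>+z. f (norm (z::'a::euclidean_space)) \<partial>lborel) =
    (\<integral>\<^sup>+t. ennreal (real DIM('a) * unit_ball_vol (real DIM('a)) * t ^ (DIM('a) - 1)) * indicator {0..} t * f t \<partial>lborel)"
proof -
  define w where "w = unit_ball_vol (real DIM('a))"
  have w: "w \<ge> 0" by (simp add: w_def)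
  let ?M = "distr lborel borel (\<lambda>z::'a. - norm z)"
  let ?g = "\<lambda>t::real. ennreal (real DIM('a) * w * (-t) ^ (DIM('a) - 1)) * indicator {..0} t"
  have cdf: "emeasure ?M {x<..} = (if x < 0 then ennreal (w * (-x) ^ DIM('a)) else 0)" for x
  proof -
    have "emeasure ?M {x<..} = emeasure lborel (ball (0::'a) (-x))"
      by (subst emeasure_distr) (auto intro!: arg_cong2[where f=emeasure])
    then show ?thesis by (cases "x < 0") (auto simp: emeasure_ball w_def ball_empty)
  qed
  \<comment> \<open>The sign of \<open>- norm z\<close> makes the upper rays in \<open>measure_eqI_lessThan\<close> have finite mass.\<close>
  have "?M = density lborel ?g"
  proof (rule measure_eqI_lessThan)
    fix x :: real
    show "emeasure ?M {x<..} < \<infinity>" by (simp add: cdf)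
    have "emeasure (density lborel ?g) {x<..} = (\<integral>\<^sup>+t. ?g t * indicator {x<..} t \<partial>lborel)"
      by (subst emeasure_density) auto
    also have "\<dots> = (\<integral>\<^sup>+t. ennreal (real DIM('a) * w * (-t) ^ (DIM('a) - 1)) * indicator {x..0} t \<partial>lborel)"
      by (rule nn_integral_cong_AE)
        (use AE_lborel_singleton[of x] in \<open>auto elim!: eventually_mono split: split_indicator\<close>)
    also have "\<dots> = (if x < 0 then ennreal (w * (-x) ^ DIM('a)) else 0)"
    proof (cases "x < 0")
      case True
      have "(\<integral>\<^sup>+t. ennreal (real DIM('a) * w * (-t) ^ (DIM('a) - 1)) * indicator {x..0} t \<partial>lborel)
          = - (w * (-0) ^ DIM('a)) - (- (w * (-x) ^ DIM('a)))"
        by (rule nn_integral_FTC_Icc[where F = "\<lambda>t. - (w * (-t) ^ DIM('a))"])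
          (use True w in \<open>auto intro!: derivative_eq_intros\<close>)
      then show ?thesis using True by (simp add: power_0_left)
    next
      case False
      have "(\<integral>\<^sup>+t. ennreal (real DIM('a) * w * (-t) ^ (DIM('a) - 1)) * indicator {x..0} t \<partial>lborel)
         = (\<integral>\<^sup>+(t::real). 0 \<partial>lborel)"
        by (rule nn_integral_cong_AE)
        (use AE_lborel_singleton[of "0::real"] False in \<open>auto elim!: eventually_mono split: split_indicator\<close>)
      then show ?thesis using False by simp
    qed
    finally show "emeasure ?M {x<..} = emeasure (density lborel ?g) {x<..}" by (simp add: cdf)
  qed auto
  then have "(\<integral>\<^sup>+s. f (- s) \<partial>?M) = (\<integral>\<^sup>+s. f (- s) \<partial>density lborel ?g)" by simp
  then have "(\<integral>\<^sup>+z. f (norm (z::'a)) \<partial>lborel) = (\<integral>\<^sup>+s. ?g s * f (-s) \<partial>lborel)"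
    by (simp add: nn_integral_distr nn_integral_density)
  also have "\<dots> = (\<integral>\<^sup>+t. ?g (-t) * f t \<partial>lborel)"
    by (subst nn_integral_real_affine[where c="-1" and t=0]) auto
  finally show ?thesis by (simp add: w_def indicator_def)
qed

section \<open>The kernel and its mass on shells\<close>

definition kern :: "real \<Rightarrow> real set \<Rightarrow> 'a::euclidean_space \<Rightarrow> ennreal" where
  "kern \<sigma> S z = indicator S (norm z) * ennreal (1 / norm z powr (real DIM('a) + \<sigma>))"

lemma kern_measurable [measurable]:
  "S \<in> sets borel \<Longrightarrow> (kern \<sigma> S :: 'a::euclidean_space \<Rightarrow> ennreal) \<in> borel_measurable borel"
proof -
  assume [measurable]: "S \<in> sets borel"
  have [measurable]: "(\<lambda>z::'a. indicator S (norm z) :: ennreal) \<in> borel_measurable borel"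
    by (rule measurable_compose[OF borel_measurable_norm]) auto
  show ?thesis unfolding kern_def[abs_def] powr_def by measurable
qed

lemma unit_ball_measure_eq:
  "unit_ball_measure TYPE('a::euclidean_space) = unit_ball_vol (real DIM('a))"
  using content_ball[of 1 "0::'a"] by (simp add: unit_ball_measure_def)

text \<open>In both branches of the definition the derivative is the kernel at distance
  \<open>t\<close> times the area of the sphere of radius \<open>t\<close>. Thus \<gamma> is the
  primitive of the radial mass density that vanishes at \<open>t = 1\<close>.\<close>

lemma gamma_const_has_derivative:
  assumes "t > 0"
  shows "(gamma_const TYPE('a::euclidean_space) \<sigma> has_real_derivative
     real DIM('a) * unit_ball_measure TYPE('a) * t powr (- \<sigma> - 1)) (at t)"
proof (cases "\<sigma> = 0")
  case True
  then show ?thesis using assms unfolding gamma_const_def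
    by (auto intro!: derivative_eq_intros simp: powr_minus divide_simps)
next
  case False
  then show ?thesis using assms unfolding gamma_const_def
    by (auto intro!: derivative_eq_intros)
qed

lemma gamma_const_mono:
  assumes "0 < r" "r \<le> s"
  shows "gamma_const TYPE('a::euclidean_space) \<sigma> r \<le> gamma_const TYPE('a) \<sigma> s"
proof (rule DERIV_nonneg_imp_nondecreasing[OF assms(2)])
  fix t assume "r \<le> t" "t \<le> s"
  then show "\<exists>y. (gamma_const TYPE('a) \<sigma> has_real_derivative y) (at t) \<and> 0 \<le> y"
    using assms gamma_const_has_derivative[of t \<sigma>, where 'a='a]
    by (intro exI conjI) (auto simp: unit_ball_measure_eq)
qed

text \<open>In polar coordinates the kernel times \<open>t ^ (d - 1)\<close> becomes
  \<open>t powr (- \<sigma> - 1)\<close>, which is the derivative of \<gamma> up to the constant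
  factor.\<close>

lemma nn_integral_kern_shell_pos:
  assumes "0 < r" "r \<le> s"
  shows "(\<integral>\<^sup>+z. kern \<sigma> {r..<s} (z::'a::euclidean_space) \<partial>lborel) =
    ennreal (gamma_const TYPE('a) \<sigma> s - gamma_const TYPE('a) \<sigma> r)"
proof -
  let ?d = "real DIM('a)" and ?w = "unit_ball_measure TYPE('a)"
  have w: "?w \<ge> 0" by (simp add: unit_ball_measure_eq)
  have pow: "t ^ (DIM('a) - 1) * (1 / t powr (?d + \<sigma>)) = t powr (- \<sigma> - 1)" if "t > 0" for t :: real
  proof -
    have "t ^ (DIM('a) - 1) = t powr (?d - 1)"
      using that by (simp add: powr_realpow[symmetric] of_nat_diff)
    then show ?thesis using that by (simp add: powr_diff powr_add powr_minus field_simps)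
  qed
  have "(\<integral>\<^sup>+z. kern \<sigma> {r..<s} (z::'a) \<partial>lborel) =
     (\<integral>\<^sup>+t. ennreal (?d * unit_ball_vol ?d * t ^ (DIM('a) - 1)) * indicator {0..} t *
       (indicator {r..<s} t * ennreal (1 / t powr (?d + \<sigma>))) \<partial>lborel)"
    unfolding kern_def by (rule nn_integral_norm_polar) measurable
  \<comment> \<open>The shell omits its outer radius; adding this null point gives a closed interval
    for the fundamental theorem of calculus.\<close>
  also have "\<dots> = (\<integral>\<^sup>+t. ennreal (?d * ?w * t powr (- \<sigma> - 1)) * indicator {r..s} t \<partial>lborel)"
  proof (rule nn_integral_cong_AE, use AE_lborel_singleton[of s] in \<open>eventually_elim\<close>)
    fix t :: real assume "t \<noteq> s"
    have *: "?d * ?w * t powr (- \<sigma> - 1) = (?d * ?w * t ^ (DIM('a) - 1)) * (1 / t powr (?d + \<sigma>))" if "t > 0"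
      unfolding pow[OF that, symmetric] by (simp only: mult.assoc)
    have "ennreal (?d * ?w * t powr (- \<sigma> - 1)) = ennreal (?d * ?w * t ^ (DIM('a) - 1)) * ennreal (1 / t powr (?d + \<sigma>))" if "t > 0"
      unfolding *[OF that] using w that by (intro ennreal_mult) auto
    then show "ennreal (?d * unit_ball_vol ?d * t ^ (DIM('a) - 1)) * indicator {0..} t *
       (indicator {r..<s} t * ennreal (1 / t powr (?d + \<sigma>))) = ennreal (?d * ?w * t powr (- \<sigma> - 1)) * indicator {r..s} t"
      using \<open>t \<noteq> s\<close> \<open>0 < r\<close> by (auto split: split_indicator simp: unit_ball_measure_eq)
  qed
  also have "\<dots> = gamma_const TYPE('a) \<sigma> s - gamma_const TYPE('a) \<sigma> r"
    by (rule nn_integral_FTC_Icc) (use assms w in \<open>auto intro!: gamma_const_has_derivative\<close>)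
  finally show ?thesis .
qed

text \<open>Off the origin the sequence is eventually constant. At the origin both sides are
  \<open>0\<close> thanks to the convention \<open>1 / 0 = 0\<close>.\<close>

lemma kern_shell_LIMSEQ:
  fixes z :: "'a::euclidean_space"
  assumes "S \<longlonglongrightarrow> 0" "\<And>n. 0 < S n"
  shows "(\<lambda>n. kern \<sigma> {S n..<s} z) \<longlonglongrightarrow> kern \<sigma> {0..<s} z"
proof (cases "z = 0")
  case True
  then show ?thesis by (simp add: kern_def)
next
  case False
  then have "eventually (\<lambda>n. S n < norm z) sequentially"
    using assms(1) by (intro order_tendstoD) auto
  then have "eventually (\<lambda>n. kern \<sigma> {S n..<s} z = kern \<sigma> {0..<s} z) sequentially"
    by eventually_elim (auto simp: kern_def split: split_indicator)
  then show ?thesis by (rule tendsto_eventually)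
qed

lemma kern_mono: "S \<subseteq> T \<Longrightarrow> kern \<sigma> S z \<le> kern \<sigma> T z"
  by (auto simp: kern_def split: split_indicator)

lemma incseq_kern_shell:
  "decseq S \<Longrightarrow> incseq (\<lambda>n. kern \<sigma> {S n..<s} :: 'a::euclidean_space \<Rightarrow> ennreal)"
  unfolding incseq_def decseq_def le_fun_def by (fastforce intro!: kern_mono intro: order_trans)

lemma gamma_const_zero: "gamma_const TYPE('a::euclidean_space) \<sigma> 0 = real DIM('a) * unit_ball_measure TYPE('a) / \<sigma>"
  by (simp add: gamma_const_def)

lemma gamma_const_tendsto_zero:
  assumes "\<sigma> < 0" "S \<longlonglongrightarrow> 0" "\<And>n. 0 < S n"
  shows "(\<lambda>n. gamma_const TYPE('a::euclidean_space) \<sigma> (S n)) \<longlonglongrightarrow> gamma_const TYPE('a) \<sigma> 0"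
proof -
  have "(\<lambda>n. S n powr (-\<sigma>)) \<longlonglongrightarrow> 0"
    using assms by (intro tendsto_zero_powrI[where b="-\<sigma>"]) (auto intro!: always_eventually less_imp_le)
  then have "(\<lambda>n. real DIM('a) * unit_ball_measure TYPE('a) * ((1 - S n powr (-\<sigma>)) / \<sigma>)) \<longlonglongrightarrow>
    real DIM('a) * unit_ball_measure TYPE('a) * ((1 - 0) / \<sigma>)"
    using assms(1) by (intro tendsto_mult tendsto_divide tendsto_diff tendsto_const) auto
  then have "(\<lambda>n. gamma_const TYPE('a) \<sigma> (S n)) \<longlonglongrightarrow>
    real DIM('a) * unit_ball_measure TYPE('a) * ((1 - 0) / \<sigma>)"
    using assms(1) by (simp add: gamma_const_def)
  then show ?thesis by (simp add: gamma_const_zero)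
qed

lemma gamma_const_isCont:
  "t > 0 \<Longrightarrow> isCont (gamma_const TYPE('a::euclidean_space) \<sigma>) t"
  using gamma_const_has_derivative DERIV_isCont by blast

text \<open>The definition changes branch at exponent \<open>0\<close>. There
  \<open>(1 - t powr (-\<sigma>)) / \<sigma>\<close> is minus the difference quotient of
  \<open>t powr (-\<sigma>)\<close>, whose derivative at \<open>0\<close> is \<open>- ln t\<close>,
  so the logarithmic branch is the limit of the other.\<close>

lemma gamma_const_tendsto_exponent:
  assumes "t > 0" "\<sigma> \<longlonglongrightarrow> \<sigma>0"
  shows "(\<lambda>n. gamma_const TYPE('a::euclidean_space) (\<sigma> n) t) \<longlonglongrightarrow> gamma_const TYPE('a) \<sigma>0 t"
proof -
  have "isCont (\<lambda>\<sigma>. gamma_const TYPE('a) \<sigma> t) \<sigma>0"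
  proof (cases "\<sigma>0 = 0")
    case False
    have "isCont (\<lambda>\<sigma>. real DIM('a) * unit_ball_measure TYPE('a) * ((1 - t powr (-\<sigma>)) / \<sigma>)) \<sigma>0"
      using False assms by (intro continuous_intros) auto
    moreover have "eventually (\<lambda>\<sigma>::real. \<sigma> \<noteq> 0) (nhds \<sigma>0)"
      using False t1_space_nhds by blast
    then have "eventually (\<lambda>\<sigma>. gamma_const TYPE('a) \<sigma> t = real DIM('a) * unit_ball_measure TYPE('a) * ((1 - t powr (-\<sigma>)) / \<sigma>)) (nhds \<sigma>0)"
      by eventually_elim (simp add: gamma_const_def)
    ultimately show ?thesis by (simp add: isCont_cong)
  next
    case True
    have "((\<lambda>\<sigma>. t powr (-\<sigma>)) has_real_derivative - ln t) (at 0)"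
      using assms by (auto intro!: derivative_eq_intros)
    then have "((\<lambda>\<sigma>. - ((t powr (-\<sigma>) - 1) / \<sigma>)) \<longlongrightarrow> - (- ln t)) (at 0)"
      using assms by (intro tendsto_minus) (simp add: DERIV_def)
    then have "((\<lambda>\<sigma>. (1 - t powr (-\<sigma>)) / \<sigma>) \<longlongrightarrow> ln t) (at 0)"
      by (simp add: minus_divide_left)
    then have "((\<lambda>\<sigma>. real DIM('a) * unit_ball_measure TYPE('a) * ((1 - t powr (-\<sigma>)) / \<sigma>)) \<longlongrightarrow>
        gamma_const TYPE('a) 0 t) (at 0)"
      unfolding gamma_const_def by (simp only: not_True_eq_False if_False simp_thms) (intro tendsto_mult tendsto_const)
    then have "((\<lambda>\<sigma>. gamma_const TYPE('a) \<sigma> t) \<longlongrightarrow> gamma_const TYPE('a) 0 t) (at 0)"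
      by (rule Lim_transform_eventually) (auto simp: eventually_at_filter gamma_const_def)
    then show ?thesis using True by (simp add: isCont_def)
  qed
  then show ?thesis using assms(2) by (rule isCont_tendsto_compose)
qed

text \<open>Radius \<open>0\<close> is reached by monotone convergence from the radii
  \<open>s / (n + 1)\<close>; for \<open>\<sigma> < 0\<close> the constant \<gamma> has a finite
  limit there.\<close>

lemma nn_integral_kern_shell:
  assumes "0 < r \<or> (r = 0 \<and> \<sigma> < 0)" "r \<le> s" "0 < s"
  shows "(\<integral>\<^sup>+z. kern \<sigma> {r..<s} (z::'a::euclidean_space) \<partial>lborel) =
    ennreal (gamma_const TYPE('a) \<sigma> s - gamma_const TYPE('a) \<sigma> r)"
proof (cases "0 < r")
  case True
  then show ?thesis using assms nn_integral_kern_shell_pos by blast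
next
  case False
  with assms have r: "r = 0" "\<sigma> < 0" by auto
  define S where "S n = s * (1 / real (Suc n))" for n
  have S: "decseq S" "S \<longlonglongrightarrow> 0" "\<And>n. 0 < S n" "\<And>n. S n \<le> s"
  proof -
    have "S \<longlonglongrightarrow> s * 0" unfolding S_def
      by (intro tendsto_mult tendsto_const) (use LIMSEQ_inverse_real_of_nat in \<open>simp add: inverse_eq_divide\<close>)
    then show "S \<longlonglongrightarrow> 0" by simp
  qed (use assms in \<open>auto simp: decseq_def S_def field_simps intro: mult_mono\<close>)
  have "(\<lambda>n. \<integral>\<^sup>+z. kern \<sigma> {S n..<s} (z::'a) \<partial>lborel) \<longlonglongrightarrow> (\<integral>\<^sup>+z. kern \<sigma> {0..<s} (z::'a) \<partial>lborel)"
    by (rule nn_integral_LIMSEQ[OF incseq_kern_shell[OF S(1)]]) (auto intro: kern_shell_LIMSEQ S)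
  moreover have "(\<integral>\<^sup>+z. kern \<sigma> {S n..<s} (z::'a) \<partial>lborel) = ennreal (gamma_const TYPE('a) \<sigma> s - gamma_const TYPE('a) \<sigma> (S n))" for n
    using S by (intro nn_integral_kern_shell_pos) auto
  moreover have "(\<lambda>n. ennreal (gamma_const TYPE('a) \<sigma> s - gamma_const TYPE('a) \<sigma> (S n))) \<longlonglongrightarrow>
     ennreal (gamma_const TYPE('a) \<sigma> s - gamma_const TYPE('a) \<sigma> 0)"
    using r S by (intro tendsto_intros gamma_const_tendsto_zero) auto
  ultimately show ?thesis using r LIMSEQ_unique by simp
qed

section \<open>Interaction energies\<close>

text \<open>For \<open>A = B = E\<close> and a tail of the kernel this is the double integral in
  \<open>J_trunc\<close>. For \<open>A = E\<close>, \<open>B = - E\<close> and the kernel on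
  \<open>{0..<s}\<close> it is the \<sigma>-perimeter of \<open>E\<close> with interactions of range
  \<open>s\<close>.\<close>

definition interaction :: "('a::euclidean_space \<Rightarrow> ennreal) \<Rightarrow> 'a set \<Rightarrow> 'a set \<Rightarrow> ennreal" where
  "interaction k A B = (\<integral>\<^sup>+x. \<integral>\<^sup>+y. indicator A x * indicator B y * k (x - y) \<partial>lborel \<partial>lborel)"

text \<open>A single integral over the product space is the form to which the convergence theorems
  apply.\<close>

lemma interaction_eq_pair:
  fixes k :: "'a::euclidean_space \<Rightarrow> ennreal"
  assumes [measurable]: "k \<in> borel_measurable borel" "A \<in> sets borel" "B \<in> sets borel"
  shows "interaction k A B = (\<integral>\<^sup>+(x, y). indicator A x * indicator B y * k (x - y) \<partial>(lborel \<Otimes>\<^sub>M lborel))"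
  unfolding interaction_def by (subst lborel.nn_integral_fst[symmetric]) auto

lemma nn_integral_lborel_minus_left:
  fixes f :: "'a::euclidean_space \<Rightarrow> ennreal"
  assumes [measurable]: "f \<in> borel_measurable borel"
  shows "(\<integral>\<^sup>+y. f (x - y) \<partial>lborel) = (\<integral>\<^sup>+y. f y \<partial>lborel)"
proof -
  have "(lborel :: 'a measure) = distr lborel borel (\<lambda>y. x - y)"
    using lborel_affine[of "-1" x] by (simp add: density_1 one_ennreal_def[symmetric])
  then have "(\<integral>\<^sup>+y. f y \<partial>lborel) = (\<integral>\<^sup>+y. f y \<partial>distr lborel borel (\<lambda>y. x - y))" by simp
  then show ?thesis by (simp add: nn_integral_distr)
qed

lemma interaction_UNIV:
  fixes k :: "'a::euclidean_space \<Rightarrow> ennreal"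
  assumes [measurable]: "k \<in> borel_measurable borel" "A \<in> sets borel"
  shows "interaction k A UNIV = emeasure lborel A * (\<integral>\<^sup>+z. k z \<partial>lborel)"
proof -
  have "interaction k A UNIV = (\<integral>\<^sup>+x. indicator A x * (\<integral>\<^sup>+y. k (x - y) \<partial>lborel) \<partial>lborel)"
    unfolding interaction_def by (simp add: nn_integral_cmult)
  also have "\<dots> = emeasure lborel A * (\<integral>\<^sup>+z. k z \<partial>lborel)"
    by (simp add: nn_integral_lborel_minus_left nn_integral_multc)
  finally show ?thesis .
qed

lemma interaction_Un_right:
  fixes k :: "'a::euclidean_space \<Rightarrow> ennreal"
  assumes [measurable]: "k \<in> borel_measurable borel" "A \<in> sets borel" "B \<in> sets borel" "C \<in> sets borel"
    and "B \<inter> C = {}"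
  shows "interaction k A (B \<union> C) = interaction k A B + interaction k A C"
proof -
  have *: "indicator (B \<union> C) y = (indicator B y + indicator C y :: ennreal)" for y
    using assms(5) by (auto split: split_indicator)
  show ?thesis unfolding interaction_def *
    by (simp add: distrib_left distrib_right nn_integral_add)
qed

lemma interaction_add_kernel:
  fixes k :: "'a::euclidean_space \<Rightarrow> ennreal"
  assumes [measurable]: "k \<in> borel_measurable borel" "k' \<in> borel_measurable borel" "A \<in> sets borel" "B \<in> sets borel"
  shows "interaction (\<lambda>z. k z + k' z) A B = interaction k A B + interaction k' A B"
  unfolding interaction_def by (simp add: distrib_left nn_integral_add)

lemma interaction_swap:
  fixes k :: "'a::euclidean_space \<Rightarrow> ennreal"
  assumes [measurable]: "k \<in> borel_measurable borel" "A \<in> sets borel" "B \<in> sets borel"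
    and "\<And>z. k (- z) = k z"
  shows "interaction k A B = interaction k B A"
proof -
  have "k (x - y) = k (y - x)" for x y using assms(4)[of "y - x"] by simp
  then show ?thesis unfolding interaction_def
    by (subst lborel_pair.Fubini') (auto intro!: nn_integral_cong simp: mult_ac)
qed

lemma interaction_bound:
  fixes k :: "'a::euclidean_space \<Rightarrow> ennreal"
  assumes [measurable]: "A \<in> sets borel" "B \<in> sets borel" and "\<And>z. k z \<le> c"
  shows "interaction k A B \<le> c * emeasure lborel A * emeasure lborel B"
proof -
  have "interaction k A B \<le> (\<integral>\<^sup>+x. \<integral>\<^sup>+y. indicator A x * indicator B y * c \<partial>lborel \<partial>lborel)"
    unfolding interaction_def by (intro nn_integral_mono mult_left_mono assms) auto
  also have "\<dots> = c * emeasure lborel A * emeasure lborel B"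
    by (simp add: nn_integral_multc nn_integral_cmult mult_ac)
  finally show ?thesis .
qed

text \<open>A pair of points of \<open>A\<close> has both points in \<open>B\<close>, or its first
  point in \<open>A - B\<close>, or its first point in \<open>B\<close> and its second in
  \<open>A - B\<close>. The last two kinds are bounded by \<open>c\<close> times products of
  measures. Used in both orders, the estimate controls the absolute difference.\<close>

lemma interaction_self_perturb:
  fixes k :: "'a::euclidean_space \<Rightarrow> ennreal"
  assumes [measurable]: "k \<in> borel_measurable borel" "A \<in> sets borel" "B \<in> sets borel" and "\<And>z. k z \<le> c"
  shows "interaction k A A \<le> interaction k B B + c * emeasure lborel (sym_diff A B) * (emeasure lborel A + emeasure lborel B)"
proof -
  have "interaction k A A \<le> (\<integral>\<^sup>+x. \<integral>\<^sup>+y. indicator B x * indicator B y * k (x - y) +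
      (indicator (A - B) x * indicator A y * k (x - y) + indicator B x * indicator (A - B) y * k (x - y)) \<partial>lborel \<partial>lborel)"
    unfolding interaction_def by (intro nn_integral_mono) (auto split: split_indicator)
  also have "\<dots> = interaction k B B + (interaction k (A - B) A + interaction k B (A - B))"
    unfolding interaction_def by (simp add: nn_integral_add)
  also have "\<dots> \<le> interaction k B B + (c * emeasure lborel (A - B) * emeasure lborel A + c * emeasure lborel B * emeasure lborel (A - B))"
    by (intro add_left_mono add_mono interaction_bound assms) auto
  also have "c * emeasure lborel (A - B) * emeasure lborel A + c * emeasure lborel B * emeasure lborel (A - B)
     = c * emeasure lborel (A - B) * (emeasure lborel A + emeasure lborel B)"
    by (simp add: algebra_simps)
  also have "\<dots> \<le> c * emeasure lborel (sym_diff A B) * (emeasure lborel A + emeasure lborel B)"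
    by (intro mult_right_mono mult_left_mono emeasure_mono) auto
  finally show ?thesis by simp
qed

lemma interaction_dominated_convergence:
  fixes k :: "'a::euclidean_space \<Rightarrow> ennreal"
  assumes [measurable]: "\<And>n. K n \<in> borel_measurable borel" "k \<in> borel_measurable borel" "w \<in> borel_measurable borel"
     "A \<in> sets borel" "B \<in> sets borel"
    and bound: "\<And>n z. K n z \<le> w z" and fin: "interaction w A B < \<infinity>" and lim: "\<And>z. (\<lambda>n. K n z) \<longlonglongrightarrow> k z"
  shows "(\<lambda>n. interaction (K n) A B) \<longlonglongrightarrow> interaction k A B"
proof -
  have ind: "(\<lambda>n. indicator A x * indicator B y * K n z) \<longlonglongrightarrow> indicator A x * indicator B y * k z" for x y z
    using lim by (auto split: split_indicator)
  have "(\<lambda>n. \<integral>\<^sup>+(x, y). indicator A x * indicator B y * K n (x - y) \<partial>(lborel \<Otimes>\<^sub>M lborel))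
      \<longlonglongrightarrow> (\<integral>\<^sup>+(x, y). indicator A x * indicator B y * k (x - y) \<partial>(lborel \<Otimes>\<^sub>M lborel))"
  proof (rule nn_integral_dominated_convergence[where w="\<lambda>(x,y). indicator A x * indicator B y * w (x - y)"])
    show "(\<integral>\<^sup>+(x, y). indicator A x * indicator B y * w (x - y) \<partial>(lborel \<Otimes>\<^sub>M lborel)) < \<infinity>"
      using fin by (simp add: interaction_eq_pair)
  qed (auto simp: split_beta intro!: AE_I2 mult_left_mono bound ind)
  then show ?thesis by (simp add: interaction_eq_pair)
qed

lemma interaction_LIMSEQ_incseq:
  fixes k :: "'a::euclidean_space \<Rightarrow> ennreal"
  assumes [measurable]: "\<And>n. K n \<in> borel_measurable borel" "k \<in> borel_measurable borel"
     "A \<in> sets borel" "B \<in> sets borel"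
    and "incseq K" and lim: "\<And>z. (\<lambda>n. K n z) \<longlonglongrightarrow> k z"
  shows "(\<lambda>n. interaction (K n) A B) \<longlonglongrightarrow> interaction k A B"
proof -
  have ind: "(\<lambda>n. indicator A x * indicator B y * K n z) \<longlonglongrightarrow> indicator A x * indicator B y * k z" for x y z
    using lim by (auto split: split_indicator)
  have "(\<lambda>n. \<integral>\<^sup>+(x, y). indicator A x * indicator B y * K n (x - y) \<partial>(lborel \<Otimes>\<^sub>M lborel))
      \<longlonglongrightarrow> (\<integral>\<^sup>+(x, y). indicator A x * indicator B y * k (x - y) \<partial>(lborel \<Otimes>\<^sub>M lborel))"
    by (rule nn_integral_LIMSEQ)
      (use \<open>incseq K\<close> in \<open>auto simp: split_beta incseq_def le_fun_def intro!: mult_left_mono ind\<close>)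
  then show ?thesis by (simp add: interaction_eq_pair)
qed

section \<open>The functionals as functions of the radius\<close>

lemma gamma_const_le:
  assumes "0 < r \<or> (r = 0 \<and> \<sigma> < 0)" "r \<le> s"
  shows "gamma_const TYPE('a::euclidean_space) \<sigma> r \<le> gamma_const TYPE('a) \<sigma> s"
proof (cases "0 < r")
  case False
  with assms have *: "r = 0" "\<sigma> < 0" by auto
  have "(1 - 0) / \<sigma> \<le> (1 - s powr (- \<sigma>)) / \<sigma>"
    using * by (intro divide_right_mono_neg) auto
  then have "real DIM('a) * unit_ball_measure TYPE('a) * ((1 - 0) / \<sigma>) \<le>
    real DIM('a) * unit_ball_measure TYPE('a) * ((1 - s powr (- \<sigma>)) / \<sigma>)"
    by (intro mult_left_mono) (auto simp: unit_ball_measure_eq)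
  then show ?thesis using * by (simp add: gamma_const_def)
qed (use assms gamma_const_mono in blast)

text \<open>Nonnegative integrals do not see the completion of the measure. Outside the open ball
  the distance is at least \<open>r\<close>, whence the closed end of the tail
  \<open>{r..}\<close>.\<close>

lemma J_trunc_eq_interaction:
  fixes E :: "'a::euclidean_space set"
  assumes [measurable]: "E \<in> sets borel"
  shows "J_trunc \<sigma> r E = - enn2ereal (interaction (kern \<sigma> {r..}) E E)"
proof -
  have "(\<integral>\<^sup>+y\<in>E - ball x r. ennreal (1 / norm (x - y) powr (real DIM('a) + \<sigma>)) \<partial>lebesgue) * indicator E x
     = (\<integral>\<^sup>+y. indicator E x * indicator E y * kern \<sigma> {r..} (x - y) \<partial>lborel)" for x
  proof -
    have "(\<integral>\<^sup>+y\<in>E - ball x r. ennreal (1 / norm (x - y) powr (real DIM('a) + \<sigma>)) \<partial>lebesgue)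
      = (\<integral>\<^sup>+y. indicator E y * kern \<sigma> {r..} (x - y) \<partial>lborel)"
      unfolding nn_integral_completion
      by (intro nn_integral_cong) (auto simp: kern_def dist_norm split: split_indicator)
    then show ?thesis by (cases "x \<in> E") simp_all
  qed
  then show ?thesis unfolding J_trunc_def interaction_def nn_integral_completion by simp
qed

lemma kern_tail_bound:
  fixes z :: "'a::euclidean_space"
  assumes "0 < r" "- real DIM('a) < \<sigma>"
  shows "kern \<sigma> {r..} z \<le> ennreal (r powr - (real DIM('a) + \<sigma>))"
proof -
  have "1 / norm z powr (real DIM('a) + \<sigma>) \<le> 1 / r powr (real DIM('a) + \<sigma>)" if "r \<le> norm z"
    using that assms by (intro divide_left_mono powr_mono2 mult_pos_pos) auto
  then show ?thesis
    unfolding powr_minus inverse_eq_divide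
    by (auto simp: kern_def split: split_indicator intro!: ennreal_leI)
qed

lemma kern_split:
  "r \<le> s \<Longrightarrow> kern \<sigma> {r..} z = kern \<sigma> {s..} z + kern \<sigma> {r..<s} z"
  by (auto simp: kern_def split: split_indicator)

lemma interaction_kern_tail_finite:
  fixes E :: "'a::euclidean_space set"
  assumes [measurable]: "E \<in> sets borel" and "emeasure lborel E < \<infinity>" "0 < r" "- real DIM('a) < \<sigma>"
  shows "interaction (kern \<sigma> {r..}) E E < \<infinity>"
proof -
  have "interaction (kern \<sigma> {r..}) E E \<le> ennreal (r powr - (real DIM('a) + \<sigma>)) * emeasure lborel E * emeasure lborel E"
    by (intro interaction_bound kern_tail_bound assms)
  also have "\<dots> < \<infinity>" using assms by (simp add: ennreal_mult_less_top)
  finally show ?thesis .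
qed

text \<open>The shell around each point of \<open>E\<close> is shared between \<open>E\<close> and
  its complement, and its total mass is the increment of \<gamma>.\<close>

lemma interaction_kern_shell_add:
  fixes E :: "'a::euclidean_space set"
  assumes [measurable]: "E \<in> sets borel"
    and r: "0 < r \<or> (r = 0 \<and> \<sigma> < 0)" "r \<le> s" "0 < s"
  shows "interaction (kern \<sigma> {r..<s}) E E + interaction (kern \<sigma> {r..<s}) E (- E) =
    emeasure lborel E * ennreal (gamma_const TYPE('a) \<sigma> s - gamma_const TYPE('a) \<sigma> r)"
  using interaction_Un_right[of "kern \<sigma> {r..<s}" E E "- E"] interaction_UNIV[of "kern \<sigma> {r..<s}" E]
     nn_integral_kern_shell[OF r, where 'a='a] by simp

text \<open>Passing from \<open>s\<close> to \<open>r\<close> subtracts the shell energy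
  \<open>X\<close> inside \<open>E\<close> and adds the increment of \<gamma> times
  \<open>m\<close>. These differ by the energy \<open>Y\<close> between \<open>E\<close> and its
  complement, since \<open>X + Y\<close> equals that increment times \<open>m\<close>. Real
  witnesses keep the subtraction legitimate; the upper bound on \<open>b\<close> serves continuity
  in the radius.\<close>

lemma J_hat_trunc_split:
  fixes E :: "'a::euclidean_space set"
  assumes [measurable]: "E \<in> sets borel" and fin: "emeasure lborel E < \<infinity>" and \<sigma>: "- real DIM('a) < \<sigma>"
    and r: "0 < r \<or> (r = 0 \<and> \<sigma> < 0)" "r \<le> s" "0 < s"
  obtains a b where "J_hat_trunc \<sigma> s E = ereal a" "J_hat_trunc \<sigma> r E = ereal (a + b)"
    "interaction (kern \<sigma> {r..<s}) E (- E) = ennreal b" "0 \<le> b"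
    "b \<le> (gamma_const TYPE('a) \<sigma> s - gamma_const TYPE('a) \<sigma> r) * measure lborel E"
proof -
  define g where "g t = gamma_const TYPE('a) \<sigma> t" for t
  define m where "m = measure lborel E"
  have g: "0 \<le> g s - g r" using gamma_const_le[OF r(1,2), where 'a='a] by (simp add: g_def)
  have m: "0 \<le> m" "emeasure lborel E = ennreal m"
    using fin by (auto simp: m_def emeasure_eq_ennreal_measure)
  have sum: "interaction (kern \<sigma> {r..<s}) E E + interaction (kern \<sigma> {r..<s}) E (- E) = ennreal (m * (g s - g r))"
    using interaction_kern_shell_add[OF assms(1) r] m g by (simp add: g_def[symmetric] ennreal_mult)
  have "interaction (kern \<sigma> {r..<s}) E E \<noteq> \<infinity>" "interaction (kern \<sigma> {r..<s}) E (- E) \<noteq> \<infinity>"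
    using sum by (metis ennreal_neq_top ennreal_add_eq_top infinity_ennreal_def)+
  then obtain X Y where X: "interaction (kern \<sigma> {r..<s}) E E = ennreal X" "0 \<le> X"
    and Y: "interaction (kern \<sigma> {r..<s}) E (- E) = ennreal Y" "0 \<le> Y"
    by (metis ennreal_cases infinity_ennreal_def)
  have XY: "X + Y = m * (g s - g r)"
    using sum X Y m g by (simp flip: ennreal_plus)
  obtain A where A: "interaction (kern \<sigma> {s..}) E E = ennreal A" "0 \<le> A"
    using interaction_kern_tail_finite[OF assms(1) fin r(3) \<sigma>] by (metis ennreal_cases infinity_ennreal_def less_irrefl)
  have "interaction (kern \<sigma> {r..}) E E = interaction (\<lambda>z. kern \<sigma> {s..} z + kern \<sigma> {r..<s} z) E E"
    unfolding interaction_def by (simp only: kern_split[OF r(2), of \<sigma>])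
  also have "\<dots> = ennreal (A + X)"
    using A X by (simp add: interaction_add_kernel)
  finally have *: "interaction (kern \<sigma> {r..}) E E = ennreal (A + X)" .
  have "J_hat_trunc \<sigma> s E = ereal (- A - g s * m)" "J_hat_trunc \<sigma> r E = ereal (- (A + X) - g r * m)"
    using A X by (simp_all add: J_hat_trunc_def J_trunc_eq_interaction * g_def m_def del: ennreal_plus)
  moreover have "- (A + X) - g r * m = (- A - g s * m) + Y"
    using XY by (simp add: algebra_simps)
  moreover have "Y \<le> (g s - g r) * m" using XY X by (simp add: algebra_simps)
  ultimately show ?thesis using that Y by (simp add: g_def m_def)
qed

text \<open>Since \<open>0 powr a = 0\<close>, the truncated functional at radius \<open>0\<close> has a meaning for
  \<open>\<sigma> < 0\<close>, with \<open>\<gamma> = d \<omega>\<^sub>d / \<sigma>\<close>.\<close>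

lemma J_hat_zero_neg:
  fixes E :: "'a::euclidean_space set"
  assumes "\<sigma> < 0"
  shows "J_hat_zero \<sigma> E = J_hat_trunc \<sigma> 0 E"
  using assms by (simp add: J_hat_zero_def J_hat_trunc_def J_trunc_def gamma_const_zero)

lemma J_hat_pos: "0 < r \<Longrightarrow> J_hat \<sigma> r E = J_hat_trunc \<sigma> r E"
  by (simp add: J_hat_def)

lemma J_hat_finite:
  fixes E :: "'a::euclidean_space set"
  assumes "E \<in> sets borel" "emeasure lborel E < \<infinity>" "- real DIM('a) < \<sigma>" "0 < s"
  obtains a where "J_hat \<sigma> s E = ereal a"
  using J_hat_trunc_split[OF assms(1-3), of s s] assms(4) by (auto simp: J_hat_pos)

text \<open>The renormalisation \<open>\<gamma>\<close> is exactly the mass of the kernel on shells, so shrinking the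
  radius adds a nonlocal perimeter. This describes all the functionals, for every
  \<open>\<sigma>\<close> and also at radius \<open>0\<close>, as a finite term plus a nonnegative one.\<close>

lemma J_hat_split:
  fixes E :: "'a::euclidean_space set"
  assumes [measurable]: "E \<in> sets borel" and fin: "emeasure lborel E < \<infinity>" and \<sigma>: "- real DIM('a) < \<sigma>"
    and r: "0 \<le> r" "r \<le> s" "0 < s"
  shows "J_hat \<sigma> r E = J_hat \<sigma> s E + enn2ereal (interaction (kern \<sigma> {r..<s}) E (- E))"
proof (cases "0 < r \<or> (r = 0 \<and> \<sigma> < 0)")
  case True
  have "J_hat \<sigma> r E = J_hat_trunc \<sigma> r E" using True by (auto simp: J_hat_def J_hat_zero_neg)
  with J_hat_trunc_split[OF assms(1-3) True r(2,3)] r show ?thesis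
    by (metis J_hat_pos enn2ereal_ennreal plus_ereal.simps(1))
next
  case False
  with r have r0: "r = 0" "\<not> \<sigma> < 0" by auto
  let ?P = "\<lambda>r. interaction (kern \<sigma> {r..<s}) E (- E)"
  obtain a where a: "J_hat \<sigma> s E = ereal a" using J_hat_finite[OF assms(1-3) r(3)] .
  \<comment> \<open>Here the value at radius \<open>0\<close> is by definition a limit. The shells
    increase as the inner radius decreases, so monotone convergence identifies this limit even if it
    is infinite; adding it to the finite \<open>a\<close> is harmless.\<close>
  have "(?P \<longlongrightarrow> ?P 0) (at_right 0)"
  proof (rule tendsto_at_right_sequentially[OF r(3)])
    fix S :: "nat \<Rightarrow> real" assume S: "\<And>n. 0 < S n" "decseq S" "S \<longlonglongrightarrow> 0"
    show "(\<lambda>n. ?P (S n)) \<longlonglongrightarrow> ?P 0"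
      by (rule interaction_LIMSEQ_incseq) (auto intro: S kern_shell_LIMSEQ incseq_kern_shell)
  qed
  then have "((\<lambda>r. ereal a + enn2ereal (?P r)) \<longlongrightarrow> ereal a + enn2ereal (?P 0)) (at_right 0)"
    by (intro tendsto_add_ereal_general tendsto_const continuous_on_tendsto_compose[OF continuous_on_enn2ereal]) auto
  moreover have "eventually (\<lambda>r. ereal a + enn2ereal (?P r) = J_hat_trunc \<sigma> r E) (at_right 0)"
  proof -
    have "eventually (\<lambda>r. r \<in> {0<..<s}) (at_right 0)" using eventually_at_right_real[OF r(3)] .
    then show ?thesis
    proof eventually_elim
      case (elim t)
      then have "0 < t \<or> (t = 0 \<and> \<sigma> < 0)" "t \<le> s" by auto
      from J_hat_trunc_split[OF assms(1-3) this r(3)] a show ?case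
        by (metis J_hat_pos enn2ereal_ennreal plus_ereal.simps(1) ereal.inject r(3))
    qed
  qed
  ultimately have "((\<lambda>r. J_hat_trunc \<sigma> r E) \<longlongrightarrow> ereal a + enn2ereal (?P 0)) (at_right 0)"
    by (rule Lim_transform_eventually)
  then have "J_hat_zero \<sigma> E = ereal a + enn2ereal (?P 0)"
    unfolding J_hat_zero_def using r0 by (simp add: tendsto_Lim)
  then show ?thesis using r0 a by (simp add: J_hat_def)
qed

lemma J_hat_antimono:
  fixes E :: "'a::euclidean_space set"
  assumes "E \<in> sets borel" "emeasure lborel E < \<infinity>" "- real DIM('a) < \<sigma>" "0 \<le> r" "r \<le> s"
  shows "J_hat \<sigma> s E \<le> J_hat \<sigma> r E"
proof (cases "0 < s")
  case True
  show ?thesis unfolding J_hat_split[OF assms True]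
    by (simp add: add_increasing2)
next
  case False
  then have "r = s" using assms by auto
  then show ?thesis by simp
qed

text \<open>Two positive radii give energies differing by at most the difference of the constants
  \<gamma> times the measure of \<open>E\<close>, and \<gamma> is continuous. The radii
  \<open>S n\<close> may lie on either side of \<open>r\<close>, hence the two cases.\<close>

lemma J_hat_isCont_radius:
  fixes E :: "'a::euclidean_space set"
  assumes E: "E \<in> sets borel" "emeasure lborel E < \<infinity>" and \<sigma>: "- real DIM('a) < \<sigma>" and "0 < r"
    and S: "S \<longlonglongrightarrow> r"
  shows "(\<lambda>n. J_hat \<sigma> (S n) E) \<longlonglongrightarrow> J_hat \<sigma> r E"
proof -
  let ?g = "gamma_const TYPE('a) \<sigma>" and ?m = "measure lborel E"
  obtain a where a: "J_hat \<sigma> r E = ereal a" using J_hat_finite[OF E \<sigma> \<open>0 < r\<close>] .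
  have g: "(\<lambda>n. ?g (S n)) \<longlonglongrightarrow> ?g r"
    using S gamma_const_isCont[OF \<open>0 < r\<close>] by (rule isCont_tendsto_compose[rotated])
  have "eventually (\<lambda>n. 0 < S n) sequentially" using S \<open>0 < r\<close> by (rule order_tendstoD)
  then have bounds: "eventually (\<lambda>n. ereal (a - \<bar>?g r - ?g (S n)\<bar> * ?m) \<le> J_hat \<sigma> (S n) E \<and>
     J_hat \<sigma> (S n) E \<le> ereal (a + \<bar>?g r - ?g (S n)\<bar> * ?m)) sequentially"
  proof eventually_elim
    case (elim n)
    show ?case
    proof (cases "S n \<le> r")
      case True
      obtain x b where *: "J_hat \<sigma> r E = ereal x" "J_hat \<sigma> (S n) E = ereal (x + b)" "0 \<le> b"
          "b \<le> (?g r - ?g (S n)) * ?m"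
        using J_hat_trunc_split[OF E \<sigma> _ True \<open>0 < r\<close>] elim by (metis J_hat_pos \<open>0 < r\<close>)
      have "(?g r - ?g (S n)) * ?m \<le> \<bar>?g r - ?g (S n)\<bar> * ?m"
        by (intro mult_right_mono) auto
      with * a show ?thesis by (auto intro: order_trans)
    next
      case False
      then have le: "r \<le> S n" by simp
      obtain x b where *: "J_hat \<sigma> (S n) E = ereal x" "J_hat \<sigma> r E = ereal (x + b)" "0 \<le> b"
          "b \<le> (?g (S n) - ?g r) * ?m"
        using J_hat_trunc_split[OF E \<sigma> _ le elim] by (metis J_hat_pos \<open>0 < r\<close> elim)
      have "(?g (S n) - ?g r) * ?m \<le> \<bar>?g r - ?g (S n)\<bar> * ?m"
        by (intro mult_right_mono) auto
      with * a show ?thesis by auto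
    qed
  qed
  have z: "(\<lambda>n. \<bar>?g r - ?g (S n)\<bar> * ?m) \<longlonglongrightarrow> \<bar>?g r - ?g r\<bar> * ?m"
    by (intro tendsto_intros g)
  show ?thesis
  proof (rule tendsto_sandwich)
    show "(\<lambda>n. ereal (a - \<bar>?g r - ?g (S n)\<bar> * ?m)) \<longlonglongrightarrow> J_hat \<sigma> r E"
      unfolding a using tendsto_diff[OF tendsto_const z, of a] by simp
    show "(\<lambda>n. ereal (a + \<bar>?g r - ?g (S n)\<bar> * ?m)) \<longlonglongrightarrow> J_hat \<sigma> r E"
      unfolding a using tendsto_add[OF tendsto_const z, of a] by simp
  qed (use bounds in \<open>auto elim: eventually_mono\<close>)
qed

section \<open>Convergence at fixed radius and the two inequalities\<close>

lemma J_hat_eq_real: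
  fixes E :: "'a::euclidean_space set"
  assumes "E \<in> sets borel" "emeasure lborel E < \<infinity>" "- real DIM('a) < \<sigma>" "0 < r"
  shows "J_hat \<sigma> r E = ereal (- enn2real (interaction (kern \<sigma> {r..}) E E) - gamma_const TYPE('a) \<sigma> r * measure lborel E)"
proof -
  obtain A where "interaction (kern \<sigma> {r..}) E E = ennreal A" "0 \<le> A"
    using interaction_kern_tail_finite[OF assms(1,2,4,3)] by (metis ennreal_cases infinity_ennreal_def less_irrefl)
  then show ?thesis using assms by (simp add: J_hat_pos J_hat_trunc_def J_trunc_eq_interaction)
qed

lemma kern_tendsto:
  fixes z :: "'a::euclidean_space"
  assumes "\<sigma> \<longlonglongrightarrow> \<sigma>0"
  shows "(\<lambda>n. kern (\<sigma> n) S z) \<longlonglongrightarrow> kern \<sigma>0 S z"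
proof (cases "z = 0")
  case True
  then show ?thesis by (simp add: kern_def)
next
  case False
  then have "(\<lambda>n. ennreal (1 / norm z powr (real DIM('a) + \<sigma> n))) \<longlonglongrightarrow> ennreal (1 / norm z powr (real DIM('a) + \<sigma>0))"
    by (intro tendsto_intros assms) auto
  then show ?thesis unfolding kern_def by (auto split: split_indicator)
qed

lemma measure_diff_le_sym_diff:
  assumes "A \<in> sets M" "B \<in> sets M" "emeasure M A < \<infinity>" "emeasure M B < \<infinity>"
  shows "\<bar>measure M A - measure M B\<bar> \<le> measure M (sym_diff A B)"
proof -
  have fin: "A \<in> fmeasurable M" "B \<in> fmeasurable M" using assms by (auto intro: fmeasurableI)
  have "measure M X \<le> measure M Y + measure M (sym_diff X Y)" if "X \<in> fmeasurable M" "Y \<in> fmeasurable M" for X Y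
  proof -
    have "measure M X \<le> measure M (Y \<union> sym_diff X Y)"
      using that by (intro measure_mono_fmeasurable) auto
    also have "\<dots> \<le> measure M Y + measure M (sym_diff X Y)"
      using that by (intro measure_Un_le) auto
    finally show ?thesis .
  qed
  from this[OF fin] this[OF fin(2,1)] show ?thesis by (auto simp: Un_commute)
qed

text \<open>At a positive radius all kernels share a bound \<open>c\<close>, so replacing
  \<open>En n\<close> by \<open>E\<close> changes the double integral by at most
  \<open>c * \<delta> n * (mn n + m)\<close>. On the fixed set \<open>E\<close>, dominated
  convergence then moves the exponent.\<close>

lemma J_hat_tendsto:
  fixes E :: "'a::euclidean_space set"
  assumes E: "E \<in> sets borel" "emeasure lborel E < \<infinity>"
    and En: "\<And>n. En n \<in> sets borel" "\<And>n. emeasure lborel (En n) < \<infinity>"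
    and lim: "(\<lambda>n. measure lborel (sym_diff (En n) E)) \<longlonglongrightarrow> 0"
    and \<sigma>: "\<sigma> \<longlonglongrightarrow> \<sigma>0" "\<And>n. - real DIM('a) < \<sigma> n" "- real DIM('a) < \<sigma>0"
    and r: "0 < r"
  shows "(\<lambda>n. J_hat (\<sigma> n) r (En n)) \<longlonglongrightarrow> J_hat \<sigma>0 r E"
proof -
  note [measurable] = E(1) En(1)
  define m where "m = measure lborel E"
  define mn where "mn n = measure lborel (En n)" for n
  define \<delta> where "\<delta> n = measure lborel (sym_diff (En n) E)" for n
  have \<delta>: "\<delta> \<longlonglongrightarrow> 0" using lim by (simp add: \<delta>_def[abs_def])
  have mn: "mn \<longlonglongrightarrow> m"
  proof (rule Lim_null[THEN iffD2], rule Lim_null_comparison)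
    show "eventually (\<lambda>n. norm (mn n - m) \<le> \<delta> n) sequentially"
      unfolding mn_def m_def \<delta>_def real_norm_def using E En
      by (intro always_eventually allI measure_diff_le_sym_diff) auto
    show "\<delta> \<longlonglongrightarrow> 0" by (rule \<delta>)
  qed
  have pos: "0 \<le> m" "0 \<le> mn n" "0 \<le> \<delta> n" for n by (simp_all add: m_def mn_def \<delta>_def)
  have em: "emeasure lborel E = ennreal m" "emeasure lborel (En n) = ennreal (mn n)" for n
    using E(2) En(2)[of n] by (auto simp: m_def mn_def emeasure_eq_ennreal_measure)
  have esd: "emeasure lborel (sym_diff (En n) E) = ennreal (\<delta> n)" for n
  proof -
    have "emeasure lborel (sym_diff (En n) E) \<le> emeasure lborel (En n \<union> E)" by (intro emeasure_mono) auto
    also have "\<dots> \<le> emeasure lborel (En n) + emeasure lborel E" by (intro emeasure_subadditive) auto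
    also have "\<dots> < \<infinity>" using E En by simp
    finally show ?thesis by (simp add: \<delta>_def emeasure_eq_ennreal_measure)
  qed
  have esd': "emeasure lborel (sym_diff E (En n)) = ennreal (\<delta> n)" for n
    using esd[of n] by (metis Un_commute)
  \<comment> \<open>Boundedness of this convergent sequence provides the bound \<open>c\<close>
    uniform in \<open>n\<close>.\<close>
  have "convergent (\<lambda>n. r powr - (real DIM('a) + \<sigma> n))"
    by (rule convergentI[of _ "r powr - (real DIM('a) + \<sigma>0)"], intro tendsto_intros \<sigma>(1)) (use r in auto)
  then have "Bseq (\<lambda>n. r powr - (real DIM('a) + \<sigma> n))" by (rule convergent_imp_Bseq)
  then obtain c where c: "0 < c" "\<And>n. norm (r powr - (real DIM('a) + \<sigma> n)) \<le> c"
    by (rule BseqE) auto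
  have kb: "kern (\<sigma> n) {r..} z \<le> ennreal c" for n and z :: 'a
    by (rule order_trans[OF kern_tail_bound[OF r \<sigma>(2)]]) (use c(2)[of n] in \<open>simp only: real_norm_def abs_of_nonneg powr_ge_zero ennreal_leI\<close>)
  define a where "a n = enn2real (interaction (kern (\<sigma> n) {r..}) (En n) (En n))" for n
  define b where "b n = enn2real (interaction (kern (\<sigma> n) {r..}) E E)" for n
  have a: "interaction (kern (\<sigma> n) {r..}) (En n) (En n) = ennreal (a n)" for n
    using interaction_kern_tail_finite[OF En(1,2) r \<sigma>(2)] by (simp add: a_def)
  have b: "interaction (kern (\<sigma> n) {r..}) E E = ennreal (b n)" for n
    using interaction_kern_tail_finite[OF E r \<sigma>(2)] by (simp add: b_def)
  have ab: "0 \<le> a n" "0 \<le> b n" for n by (simp_all add: a_def b_def)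
  have "(\<lambda>n. interaction (kern (\<sigma> n) {r..}) E E) \<longlonglongrightarrow> interaction (kern \<sigma>0 {r..}) E E"
  proof (rule interaction_dominated_convergence[where w = "\<lambda>_. ennreal c"])
    have "interaction (\<lambda>_. ennreal c) E E \<le> ennreal c * emeasure lborel E * emeasure lborel E"
      by (intro interaction_bound) auto
    also have "\<dots> < \<infinity>" using E by (simp add: ennreal_mult_less_top)
    finally show "interaction (\<lambda>_. ennreal c) E E < \<infinity>" .
  qed (auto intro: kb kern_tendsto \<sigma>)
  then have blim: "b \<longlonglongrightarrow> enn2real (interaction (kern \<sigma>0 {r..}) E E)"
    unfolding b_def using interaction_kern_tail_finite[OF E r \<sigma>(3)] by (intro tendsto_enn2real) auto
  have diff: "\<bar>a n - b n\<bar> \<le> c * \<delta> n * (mn n + m)" for n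
  proof -
    have "ennreal (a n) \<le> ennreal (b n) + ennreal c * ennreal (\<delta> n) * (ennreal (mn n) + ennreal m)"
      using interaction_self_perturb[of "kern (\<sigma> n) {r..}" "En n" E, OF _ _ _ kb] by (simp only: a b em esd) simp
    also have "\<dots> = ennreal (b n + c * \<delta> n * (mn n + m))"
      using c pos ab by (simp add: ennreal_mult ennreal_plus)
    finally have 1: "a n \<le> b n + c * \<delta> n * (mn n + m)"
      using c pos ab by (subst (asm) ennreal_le_iff) auto
    have "ennreal (b n) \<le> ennreal (a n) + ennreal c * ennreal (\<delta> n) * (ennreal m + ennreal (mn n))"
      using interaction_self_perturb[of "kern (\<sigma> n) {r..}" E "En n", OF _ _ _ kb] by (simp only: a b em esd') simp
    also have "\<dots> = ennreal (a n + c * \<delta> n * (m + mn n))"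
      using c pos ab by (simp add: ennreal_mult ennreal_plus)
    finally have 2: "b n \<le> a n + c * \<delta> n * (m + mn n)"
      using c pos ab by (subst (asm) ennreal_le_iff) auto
    show ?thesis using 1 2 by (simp add: add.commute abs_le_iff)
  qed
  have "(\<lambda>n. c * \<delta> n * (mn n + m)) \<longlonglongrightarrow> c * 0 * (m + m)"
    by (intro tendsto_mult tendsto_add tendsto_const mn \<delta>)
  then have z: "(\<lambda>n. c * \<delta> n * (mn n + m)) \<longlonglongrightarrow> 0"
    by (simp only: mult_zero_right mult_zero_left)
  have "(\<lambda>n. a n - b n) \<longlonglongrightarrow> 0"
    by (rule Lim_null_comparison[OF _ z], rule always_eventually, rule allI, unfold real_norm_def, rule diff)
  from tendsto_add[OF this blim] have alim: "a \<longlonglongrightarrow> enn2real (interaction (kern \<sigma>0 {r..}) E E)" by simp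
  have "(\<lambda>n. ereal (- a n - gamma_const TYPE('a) (\<sigma> n) r * mn n)) \<longlonglongrightarrow>
     ereal (- enn2real (interaction (kern \<sigma>0 {r..}) E E) - gamma_const TYPE('a) \<sigma>0 r * m)"
    by (intro tendsto_ereal tendsto_diff tendsto_minus tendsto_mult alim mn gamma_const_tendsto_exponent[OF r \<sigma>(1)])
  then show ?thesis
    using J_hat_eq_real[OF En(1,2) \<sigma>(2) r] J_hat_eq_real[OF E \<sigma>(3) r] by (simp add: a_def m_def mn_def)
qed

text \<open>The value at radius \<open>0\<close> may be infinite, so the estimate by increments of
  \<gamma> gives way to monotone convergence of the shells.\<close>

lemma J_hat_LIMSEQ_zero_radius:
  fixes E :: "'a::euclidean_space set"
  assumes [measurable]: "E \<in> sets borel" and fin: "emeasure lborel E < \<infinity>" and \<sigma>: "- real DIM('a) < \<sigma>"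
    and S: "\<And>n. 0 < S n" "decseq S" "S \<longlonglongrightarrow> 0"
  shows "(\<lambda>n. J_hat \<sigma> (S n) E) \<longlonglongrightarrow> J_hat \<sigma> 0 E"
proof -
  let ?P = "\<lambda>r. interaction (kern \<sigma> {r..<S 0}) E (- E)"
  obtain a where a: "J_hat \<sigma> (S 0) E = ereal a" using J_hat_finite[OF assms(1-3) S(1)] .
  have "(\<lambda>n. ?P (S n)) \<longlonglongrightarrow> ?P 0"
    by (rule interaction_LIMSEQ_incseq) (auto intro: S kern_shell_LIMSEQ incseq_kern_shell)
  then have "(\<lambda>n. ereal a + enn2ereal (?P (S n))) \<longlonglongrightarrow> ereal a + enn2ereal (?P 0)"
    by (intro tendsto_add_ereal_general tendsto_const tendsto_enn2erealI) auto
  moreover have "J_hat \<sigma> (S n) E = ereal a + enn2ereal (?P (S n))" for n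
    using J_hat_split[OF assms(1-3), of "S n" "S 0"] S a by (simp add: less_imp_le decseqD)
  moreover have "J_hat \<sigma> 0 E = ereal a + enn2ereal (?P 0)"
    using J_hat_split[OF assms(1-3), of 0 "S 0"] S a by (simp add: less_imp_le)
  ultimately show ?thesis by simp
qed

section \<open>The liminf inequality\<close>

text \<open>For \<open>s > r0\<close> eventually \<open>r n < s\<close>, and monotonicity in the
  radius bounds the energies below by those at the fixed radius \<open>s\<close>, which converge.
  Then \<open>s\<close> decreases to \<open>r0\<close>.\<close>

lemma J_hat_liminf:
  fixes E :: "'a::euclidean_space set"
  assumes E: "E \<in> sets borel" "emeasure lborel E < \<infinity>"
    and En: "\<And>n. En n \<in> sets borel" "\<And>n. emeasure lborel (En n) < \<infinity>"
    and lim: "(\<lambda>n. measure lborel (sym_diff (En n) E)) \<longlonglongrightarrow> 0"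
    and \<sigma>: "\<sigma> \<longlonglongrightarrow> \<sigma>0" "\<And>n. - real DIM('a) < \<sigma> n" "- real DIM('a) < \<sigma>0"
    and r: "r \<longlonglongrightarrow> r0" "\<And>n. 0 \<le> r n" "0 \<le> r0"
  shows "J_hat \<sigma>0 r0 E \<le> liminf (\<lambda>n. J_hat (\<sigma> n) (r n) (En n))"
proof -
  have *: "J_hat \<sigma>0 s E \<le> liminf (\<lambda>n. J_hat (\<sigma> n) (r n) (En n))" if "r0 < s" for s
  proof -
    have "0 < s" using r that by simp
    have "J_hat \<sigma>0 s E = liminf (\<lambda>n. J_hat (\<sigma> n) s (En n))"
      by (rule lim_imp_Liminf[symmetric, OF _ J_hat_tendsto[OF E En lim \<sigma> \<open>0 < s\<close>]]) simp
    also have "eventually (\<lambda>n. r n < s) sequentially" using r(1) that by (rule order_tendstoD)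
    then have "liminf (\<lambda>n. J_hat (\<sigma> n) s (En n)) \<le> liminf (\<lambda>n. J_hat (\<sigma> n) (r n) (En n))"
      by (intro Liminf_mono) (auto elim!: eventually_mono intro!: J_hat_antimono En \<sigma> r)
    finally show ?thesis .
  qed
  \<comment> \<open>A decreasing sequence strictly above \<open>r0\<close> also suits
    \<open>r0 = 0\<close>, where convergence is available along decreasing positive radii.\<close>
  define S where "S n = r0 + 1 / real (Suc n)" for n
  have S0: "(\<lambda>n. 1 / real (Suc n)) \<longlonglongrightarrow> 0"
    using LIMSEQ_inverse_real_of_nat by (simp add: inverse_eq_divide)
  have "S \<longlonglongrightarrow> r0 + 0" unfolding S_def by (intro tendsto_intros S0)
  then have S: "S \<longlonglongrightarrow> r0" "decseq S" "r0 < S n" for n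
    by (auto simp: S_def decseq_def field_simps)
  have "(\<lambda>n. J_hat \<sigma>0 (S n) E) \<longlonglongrightarrow> J_hat \<sigma>0 r0 E"
  proof (cases "r0 = 0")
    case True
    then show ?thesis using J_hat_LIMSEQ_zero_radius[OF E \<sigma>(3), of S] S by auto
  next
    case False
    then show ?thesis using J_hat_isCont_radius[OF E \<sigma>(3) _ S(1)] r by auto
  qed
  then show ?thesis by (rule LIMSEQ_le_const2) (use * S in auto)
qed

section \<open>The limsup inequality along constant sequences\<close>

text \<open>The comparison is now with fixed radii \<open>s\<close> below \<open>r0\<close>, which
  can be taken positive because \<open>r0\<close> is.\<close>

lemma J_hat_limsup_pos_radius:
  fixes E :: "'a::euclidean_space set"
  assumes E: "E \<in> sets borel" "emeasure lborel E < \<infinity>"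
    and \<sigma>: "\<sigma> \<longlonglongrightarrow> \<sigma>0" "\<And>n. - real DIM('a) < \<sigma> n" "- real DIM('a) < \<sigma>0"
    and r: "r \<longlonglongrightarrow> r0" "0 < r0"
  shows "limsup (\<lambda>n. J_hat (\<sigma> n) (r n) E) \<le> J_hat \<sigma>0 r0 E"
proof -
  have *: "limsup (\<lambda>n. J_hat (\<sigma> n) (r n) E) \<le> J_hat \<sigma>0 s E" if "s < r0" "0 < s" for s
  proof -
    have "eventually (\<lambda>n. s < r n) sequentially" using r(1) that(1) by (rule order_tendstoD)
    then have "limsup (\<lambda>n. J_hat (\<sigma> n) (r n) E) \<le> limsup (\<lambda>n. J_hat (\<sigma> n) s E)"
      using that by (intro Limsup_mono) (auto elim!: eventually_mono intro!: J_hat_antimono E \<sigma>)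
    also have "\<dots> = J_hat \<sigma>0 s E"
      using that by (intro lim_imp_Limsup J_hat_tendsto E \<sigma>) auto
    finally show ?thesis .
  qed
  \<comment> \<open>The double successor starts the sequence at \<open>r0 / 2\<close> and so keeps
    every \<open>S n\<close> positive.\<close>
  define S where "S n = r0 - r0 * (1 / real (Suc (Suc n)))" for n
  have S0: "(\<lambda>n. 1 / real (Suc (Suc n))) \<longlonglongrightarrow> 0"
    using LIMSEQ_Suc[OF LIMSEQ_inverse_real_of_nat] by (simp add: inverse_eq_divide)
  have "S \<longlonglongrightarrow> r0 - r0 * 0" unfolding S_def by (intro tendsto_intros S0)
  then have S: "S \<longlonglongrightarrow> r0" "0 < S n" "S n < r0" for n
    using r(2) by (auto simp: S_def field_simps add_pos_nonneg)
  have "(\<lambda>n. J_hat \<sigma>0 (S n) E) \<longlonglongrightarrow> J_hat \<sigma>0 r0 E"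
    using J_hat_isCont_radius[OF E \<sigma>(3) r(2) S(1)] .
  then show ?thesis by (rule LIMSEQ_le_const) (use * S in auto)
qed

text \<open>At distances at most \<open>1\<close> a larger exponent makes the power smaller and its
  reciprocal larger.\<close>

lemma kern_mono_exponent:
  "\<sigma> \<le> \<sigma>' \<Longrightarrow> S \<subseteq> {0..1} \<Longrightarrow> kern \<sigma> S z \<le> kern \<sigma>' S z"
  unfolding kern_def
  by (cases "z = 0") (auto split: split_indicator intro!: ennreal_leI divide_left_mono powr_mono' mult_pos_pos)

text \<open>Monotonicity in the radius reduces to \<open>r n = 0\<close>. Splitting at radius
  \<open>1\<close> leaves a part that converges and the \<sigma>-perimeters of range
  \<open>1\<close>, which converge by domination with the larger exponent
  \<open>\<sigma>'\<close>.\<close>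

lemma J_hat_limsup_zero_radius:
  fixes E :: "'a::euclidean_space set"
  assumes E: "E \<in> sets borel" "emeasure lborel E < \<infinity>"
    and \<sigma>: "\<sigma> \<longlonglongrightarrow> \<sigma>0" "\<And>n. - real DIM('a) < \<sigma> n" "- real DIM('a) < \<sigma>0"
    and \<sigma>': "\<sigma>0 < \<sigma>'" "interaction (kern \<sigma>' {0..<1}) E (- E) < \<infinity>"
    and r: "\<And>n. 0 \<le> r n"
  shows "limsup (\<lambda>n. J_hat (\<sigma> n) (r n) E) \<le> J_hat \<sigma>0 0 E"
proof -
  note [measurable] = E(1)
  let ?P = "\<lambda>\<sigma>. interaction (kern \<sigma> {0..<1}) E (- E)"
  obtain a where a: "J_hat \<sigma>0 1 E = ereal a" using J_hat_finite[OF E \<sigma>(3), of 1] by auto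
  \<comment> \<open>Capping the exponents at \<open>\<sigma>'\<close> makes the domination hold for
    every \<open>n\<close>; for large \<open>n\<close> the cap is inactive.\<close>
  have "(\<lambda>n. min (\<sigma> n) \<sigma>') \<longlonglongrightarrow> min \<sigma>0 \<sigma>'" by (intro tendsto_intros \<sigma>)
  then have min: "(\<lambda>n. min (\<sigma> n) \<sigma>') \<longlonglongrightarrow> \<sigma>0" using \<sigma>' by simp
  have "(\<lambda>n. ?P (min (\<sigma> n) \<sigma>')) \<longlonglongrightarrow> ?P \<sigma>0"
    by (rule interaction_dominated_convergence[where w="kern \<sigma>' {0..<1}"])
      (use \<sigma>'(2) in \<open>auto intro!: kern_mono_exponent kern_tendsto min\<close>)
  moreover have "eventually (\<lambda>n. \<sigma> n < \<sigma>') sequentially" using \<sigma>(1) \<sigma>'(1) by (rule order_tendstoD)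
  then have "eventually (\<lambda>n. ?P (min (\<sigma> n) \<sigma>') = ?P (\<sigma> n)) sequentially" by eventually_elim simp
  ultimately have P: "(\<lambda>n. ?P (\<sigma> n)) \<longlonglongrightarrow> ?P \<sigma>0" by (rule Lim_transform_eventually)
  have "(\<lambda>n. J_hat (\<sigma> n) 1 E + enn2ereal (?P (\<sigma> n))) \<longlonglongrightarrow> J_hat \<sigma>0 1 E + enn2ereal (?P \<sigma>0)"
    using a by (intro tendsto_add_ereal_general tendsto_enn2erealI P J_hat_tendsto E \<sigma>) auto
  then have "limsup (\<lambda>n. J_hat (\<sigma> n) 0 E) = J_hat \<sigma>0 0 E"
    using J_hat_split[OF E \<sigma>(2), of 0 1] J_hat_split[OF E \<sigma>(3), of 0 1] by (intro lim_imp_Limsup) auto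
  moreover have "limsup (\<lambda>n. J_hat (\<sigma> n) (r n) E) \<le> limsup (\<lambda>n. J_hat (\<sigma> n) 0 E)"
    by (intro Limsup_mono always_eventually allI J_hat_antimono E \<sigma> r) simp
  ultimately show ?thesis by simp
qed

section \<open>Mollification and level sets\<close>

lemma nn_integral_lborel_translate:
  fixes f :: "'a::euclidean_space \<Rightarrow> ennreal"
  assumes [measurable]: "f \<in> borel_measurable borel"
  shows "(\<integral>\<^sup>+y. f (c + y) \<partial>lborel) = (\<integral>\<^sup>+y. f y \<partial>lborel)"
proof -
  have "(\<integral>\<^sup>+y. f y \<partial>lborel) = (\<integral>\<^sup>+y. f y \<partial>distr lborel borel ((+) c))"
    by (simp add: lborel_distr_plus)
  then show ?thesis by (simp add: nn_integral_distr)
qed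

text \<open>This is the convolution of the indicator of \<open>E\<close> with the reflection of
  \<rho>, hence with \<rho> itself when \<rho> is even.\<close>

definition mollify :: "('a::euclidean_space \<Rightarrow> ennreal) \<Rightarrow> 'a set \<Rightarrow> 'a \<Rightarrow> ennreal" where
  "mollify \<rho> E x = (\<integral>\<^sup>+z. \<rho> (z - x) * indicator E z \<partial>lborel)"

text \<open>Subtraction in \<open>ennreal\<close> is truncated, so only the positive part of \<open>u x - u y\<close> counts.\<close>

definition variation :: "('a::euclidean_space \<Rightarrow> ennreal) \<Rightarrow> ('a \<Rightarrow> ennreal) \<Rightarrow> ennreal" where
  "variation k u = (\<integral>\<^sup>+x. \<integral>\<^sup>+y. k (x - y) * (u x - u y) \<partial>lborel \<partial>lborel)"

lemma mollify_measurable [measurable]: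
  assumes [measurable]: "\<rho> \<in> borel_measurable borel" "E \<in> sets borel"
  shows "mollify \<rho> E \<in> borel_measurable borel"
  unfolding mollify_def[abs_def] by measurable

lemma mollify_shift:
  fixes \<rho> :: "'a::euclidean_space \<Rightarrow> ennreal"
  assumes [measurable]: "\<rho> \<in> borel_measurable borel" "E \<in> sets borel"
  shows "mollify \<rho> E x = (\<integral>\<^sup>+z. \<rho> z * indicator E (x + z) \<partial>lborel)"
  unfolding mollify_def
  by (subst nn_integral_lborel_translate[of "\<lambda>z. \<rho> (z - x) * indicator E z" x, symmetric]) simp_all

lemma mollify_le_1:
  fixes \<rho> :: "'a::euclidean_space \<Rightarrow> ennreal"
  assumes [measurable]: "\<rho> \<in> borel_measurable borel" "E \<in> sets borel" and "(\<integral>\<^sup>+z. \<rho> z \<partial>lborel) = 1"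
  shows "mollify \<rho> E x \<le> 1"
  unfolding mollify_shift[OF assms(1,2)] assms(3)[symmetric]
  by (intro nn_integral_mono) (auto split: split_indicator)

lemma mollify_compl:
  fixes \<rho> :: "'a::euclidean_space \<Rightarrow> ennreal"
  assumes [measurable]: "\<rho> \<in> borel_measurable borel" "E \<in> sets borel" and "(\<integral>\<^sup>+z. \<rho> z \<partial>lborel) = 1"
  shows "mollify \<rho> E x + mollify \<rho> (- E) x = 1"
proof -
  have "mollify \<rho> E x + mollify \<rho> (- E) x = (\<integral>\<^sup>+z. \<rho> z * indicator E (x + z) + \<rho> z * indicator (- E) (x + z) \<partial>lborel)"
    by (simp add: mollify_shift nn_integral_add)
  also have "\<dots> = (\<integral>\<^sup>+z. \<rho> z \<partial>lborel)"
    by (intro nn_integral_cong) (auto split: split_indicator)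
  finally show ?thesis using assms(3) by simp
qed

lemma interaction_mollify:
  fixes \<rho> :: "'a::euclidean_space \<Rightarrow> ennreal"
  assumes [measurable]: "\<rho> \<in> borel_measurable borel" "A \<in> sets borel" "B \<in> sets borel" and "\<And>z. \<rho> (- z) = \<rho> z"
  shows "interaction \<rho> A B = (\<integral>\<^sup>+x. indicator A x * mollify \<rho> B x \<partial>lborel)"
proof -
  have "\<rho> (x - y) = \<rho> (y - x)" for x y using assms(4)[of "y - x"] by simp
  then show ?thesis unfolding interaction_def mollify_def
    by (simp add: nn_integral_cmult[symmetric] mult_ac)
qed

section \<open>Coarea inequality and variation of mollified indicators\<close>

text \<open>A level \<open>t\<close> separates \<open>x\<close> from \<open>y\<close> exactly when
  \<open>u y \<le> t < u x\<close>, and the length of these levels is the truncated difference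
  \<open>u x - u y\<close>. Tonelli does the rest. As \<open>ennreal\<close> sends negative numbers
  to \<open>0\<close>, only positive levels are integrated.\<close>

lemma coarea_le:
  fixes k :: "'a::euclidean_space \<Rightarrow> ennreal"
  assumes [measurable]: "k \<in> borel_measurable borel" "u \<in> borel_measurable borel" and u: "\<And>x. u x \<le> 1"
  shows "(\<integral>\<^sup>+t. interaction k {x. ennreal t < u x} (- {x. ennreal t < u x}) * indicator {0<..} t \<partial>lborel) \<le> variation k u"
proof -
  define g where "g x y t = indicator {0<..} t * indicator {x. ennreal t < u x} x * indicator (- {x. ennreal t < u x}) y * k (x - y)" for x y and t :: real
  have [measurable]: "(\<lambda>(t, p). g (fst p) (snd p) t) \<in> borel_measurable (lborel \<Otimes>\<^sub>M (lborel \<Otimes>\<^sub>M lborel))"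
    unfolding g_def indicator_def split_beta by simp
  have *: "(\<integral>\<^sup>+t. g x y t \<partial>lborel) \<le> k (x - y) * (u x - u y)" for x y
  proof -
    have fin: "u x < top" "u y < top" using u[of x] u[of y] by (auto intro: le_less_trans)
    then obtain a b where ab: "u x = ennreal a" "u y = ennreal b" "0 \<le> a" "0 \<le> b"
      by (metis ennreal_cases less_irrefl infinity_ennreal_def top_neq_ennreal)
    have "(\<integral>\<^sup>+t. g x y t \<partial>lborel) \<le> (\<integral>\<^sup>+t. k (x - y) * indicator {b..<a} t \<partial>lborel)"
      unfolding g_def by (intro nn_integral_mono) (auto split: split_indicator simp: ab ennreal_less_iff not_less)
    also have "\<dots> = k (x - y) * emeasure lborel {b..<a}" by (simp add: nn_integral_cmult)
    also have "\<dots> \<le> k (x - y) * (u x - u y)"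
      by (cases "b \<le> a") (auto simp: ab ennreal_minus)
    finally show ?thesis .
  qed
  have "(\<integral>\<^sup>+t. interaction k {x. ennreal t < u x} (- {x. ennreal t < u x}) * indicator {0<..} t \<partial>lborel)
     = (\<integral>\<^sup>+t. \<integral>\<^sup>+x. \<integral>\<^sup>+y. g x y t \<partial>lborel \<partial>lborel \<partial>lborel)"
    by (intro nn_integral_cong) (auto simp: interaction_def g_def split: split_indicator)
  also have "\<dots> = (\<integral>\<^sup>+t. \<integral>\<^sup>+p. g (fst p) (snd p) t \<partial>(lborel \<Otimes>\<^sub>M lborel) \<partial>lborel)"
    by (subst lborel.nn_integral_fst[symmetric]) auto
  also have "\<dots> = (\<integral>\<^sup>+p. \<integral>\<^sup>+t. g (fst p) (snd p) t \<partial>lborel \<partial>(lborel \<Otimes>\<^sub>M lborel))"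
  proof -
    interpret pair_sigma_finite "lborel :: real measure" "lborel \<Otimes>\<^sub>M lborel :: ('a \<times> 'a) measure"
      unfolding lborel_prod ..
    show ?thesis by (rule Fubini'[symmetric]) measurable
  qed
  also have "\<dots> \<le> (\<integral>\<^sup>+p. k (fst p - snd p) * (u (fst p) - u (snd p)) \<partial>(lborel \<Otimes>\<^sub>M lborel))"
    by (intro nn_integral_mono *)
  also have "\<dots> = variation k u"
    unfolding variation_def by (subst lborel.nn_integral_fst[symmetric]) auto
  finally show ?thesis .
qed

text \<open>The positive part of an average is at most the average of the positive parts; for
  indicators the latter are indicators of \<open>x + z\<close> in \<open>E\<close> and
  \<open>y + z\<close> outside.\<close>

lemma mollify_diff_le:
  fixes \<rho> :: "'a::euclidean_space \<Rightarrow> ennreal"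
  assumes [measurable]: "\<rho> \<in> borel_measurable borel" "E \<in> sets borel" and \<rho>: "(\<integral>\<^sup>+z. \<rho> z \<partial>lborel) = 1"
  shows "mollify \<rho> E x - mollify \<rho> E y \<le> (\<integral>\<^sup>+z. \<rho> z * (indicator E (x + z) * indicator (- E) (y + z)) \<partial>lborel)"
proof -
  have "mollify \<rho> E x \<le> (\<integral>\<^sup>+z. \<rho> z * (indicator E (x + z) * indicator (- E) (y + z)) + \<rho> z * indicator E (y + z) \<partial>lborel)"
    unfolding mollify_shift[OF assms(1,2)] by (intro nn_integral_mono) (auto split: split_indicator)
  also have "\<dots> = (\<integral>\<^sup>+z. \<rho> z * (indicator E (x + z) * indicator (- E) (y + z)) \<partial>lborel) + mollify \<rho> E y"
    by (simp add: mollify_shift nn_integral_add)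
  finally have "mollify \<rho> E x \<le> mollify \<rho> E y + (\<integral>\<^sup>+z. \<rho> z * (indicator E (x + z) * indicator (- E) (y + z)) \<partial>lborel)"
    by (subst add.commute)
  moreover have "mollify \<rho> E y < top" using mollify_le_1[OF assms, of y] by (rule le_less_trans) simp
  ultimately show ?thesis by (auto simp: ennreal_minus_le_iff)
qed

lemma interaction_translate:
  fixes k :: "'a::euclidean_space \<Rightarrow> ennreal"
  assumes [measurable]: "k \<in> borel_measurable borel" "A \<in> sets borel" "B \<in> sets borel"
  shows "(\<integral>\<^sup>+x. \<integral>\<^sup>+y. k (x - y) * (indicator A (x + z) * indicator B (y + z)) \<partial>lborel \<partial>lborel) = interaction k A B"
proof -
  have "interaction k A B = (\<integral>\<^sup>+x. \<integral>\<^sup>+y. indicator A x * indicator B (z + y) * k (x - (z + y)) \<partial>lborel \<partial>lborel)"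
    unfolding interaction_def by (intro nn_integral_cong nn_integral_lborel_translate[symmetric]) simp
  also have "\<dots> = (\<integral>\<^sup>+x. \<integral>\<^sup>+y. indicator A (z + x) * indicator B (z + y) * k ((z + x) - (z + y)) \<partial>lborel \<partial>lborel)"
    by (rule nn_integral_lborel_translate[symmetric]) simp
  finally show ?thesis by (simp add: mult_ac add.commute)
qed

text \<open>Mollification averages translates of \<open>E\<close> with total weight
  \<open>1\<close>, and every translate has the same interaction with its complement.\<close>

lemma variation_mollify_le:
  fixes k \<rho> :: "'a::euclidean_space \<Rightarrow> ennreal"
  assumes [measurable]: "k \<in> borel_measurable borel" "\<rho> \<in> borel_measurable borel" "E \<in> sets borel"
    and \<rho>: "(\<integral>\<^sup>+z. \<rho> z \<partial>lborel) = 1"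
  shows "variation k (mollify \<rho> E) \<le> interaction k E (- E)"
proof -
  let ?g = "\<lambda>z p. \<rho> z * (k (fst p - snd p) * (indicator E (fst p + z) * indicator (- E) (snd p + z)))"
  have "variation k (mollify \<rho> E) \<le>
    (\<integral>\<^sup>+x. \<integral>\<^sup>+y. k (x - y) * (\<integral>\<^sup>+z. \<rho> z * (indicator E (x + z) * indicator (- E) (y + z)) \<partial>lborel) \<partial>lborel \<partial>lborel)"
    unfolding variation_def by (intro nn_integral_mono mult_left_mono mollify_diff_le \<rho>) auto
  also have "\<dots> = (\<integral>\<^sup>+x. \<integral>\<^sup>+y. \<integral>\<^sup>+z. ?g z (x, y) \<partial>lborel \<partial>lborel \<partial>lborel)"
    by (simp add: nn_integral_cmult[symmetric] mult_ac)
  also have "\<dots> = (\<integral>\<^sup>+p. \<integral>\<^sup>+z. ?g z p \<partial>lborel \<partial>(lborel \<Otimes>\<^sub>M lborel))"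
    by (subst lborel.nn_integral_fst[symmetric]) auto
  also have "\<dots> = (\<integral>\<^sup>+z. \<integral>\<^sup>+p. ?g z p \<partial>(lborel \<Otimes>\<^sub>M lborel) \<partial>lborel)"
  proof -
    interpret pair_sigma_finite "lborel :: 'a measure" "lborel \<Otimes>\<^sub>M lborel :: ('a \<times> 'a) measure"
      unfolding lborel_prod ..
    show ?thesis by (rule Fubini') (simp add: split_beta)
  qed
  also have "\<dots> = (\<integral>\<^sup>+z. \<rho> z * (\<integral>\<^sup>+p. k (fst p - snd p) * (indicator E (fst p + z) * indicator (- E) (snd p + z)) \<partial>(lborel \<Otimes>\<^sub>M lborel)) \<partial>lborel)"
    by (simp add: nn_integral_cmult)
  also have "\<dots> = (\<integral>\<^sup>+z. \<rho> z * interaction k E (- E) \<partial>lborel)"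
  proof -
    have "(\<integral>\<^sup>+p. k (fst p - snd p) * (indicator E (fst p + z) * indicator (- E) (snd p + z)) \<partial>(lborel \<Otimes>\<^sub>M lborel)) = interaction k E (- E)" for z
      by (subst interaction_translate[of k E "- E" z, symmetric]) (auto simp: lborel.nn_integral_fst[symmetric])
    then show ?thesis by simp
  qed
  also have "\<dots> = interaction k E (- E)" by (simp add: nn_integral_multc \<rho>)
  finally show ?thesis .
qed

text \<open>Truncated subtraction satisfies \<open>f \<le> g + (f - g)\<close>, and the finite
  integral of \<open>g\<close> can be moved to the other side.\<close>

lemma ennreal_minus_mono_nn_integral:
  assumes [measurable]: "f \<in> borel_measurable M" "g \<in> borel_measurable M"
    and "(\<integral>\<^sup>+x. g x \<partial>M) < top"
  shows "(\<integral>\<^sup>+x. f x \<partial>M) - (\<integral>\<^sup>+x. g x \<partial>M) \<le> (\<integral>\<^sup>+x. f x - g x \<partial>M)"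
proof -
  have "(\<integral>\<^sup>+x. f x \<partial>M) \<le> (\<integral>\<^sup>+x. g x + (f x - g x) \<partial>M)"
    by (intro nn_integral_mono) (metis diff_add_self_ennreal ennreal_minus_eq_0 add_0_right nle_le order_refl add.commute)
  also have "\<dots> = (\<integral>\<^sup>+x. g x \<partial>M) + (\<integral>\<^sup>+x. f x - g x \<partial>M)" by (simp add: nn_integral_add)
  finally show ?thesis using assms(3) by (auto simp: ennreal_minus_le_iff)
qed

text \<open>With \<open>h = x - y\<close> the variation integrates \<open>k h\<close> against the
  total positive increment of \<open>u\<close> under translation by \<open>h\<close>. Moving the
  translation onto \<rho> bounds this increment by the measure of \<open>E\<close> times
  \<open>C * norm h\<close>. The factor \<open>norm h\<close> weakens the singularity of the
  kernel.\<close>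

lemma variation_mollify_lipschitz:
  fixes k \<rho> :: "'a::euclidean_space \<Rightarrow> ennreal"
  assumes [measurable]: "k \<in> borel_measurable borel" "\<rho> \<in> borel_measurable borel" "E \<in> sets borel"
    and \<rho>: "(\<integral>\<^sup>+z. \<rho> z \<partial>lborel) = 1"
    and lip: "\<And>h. (\<integral>\<^sup>+z. \<rho> z - \<rho> (z + h) \<partial>lborel) \<le> C * ennreal (norm h)"
  shows "variation k (mollify \<rho> E) \<le> emeasure lborel E * (C * (\<integral>\<^sup>+h. k h * ennreal (norm h) \<partial>lborel))"
proof -
  let ?u = "mollify \<rho> E"
  have diff: "(\<integral>\<^sup>+x. ?u x - ?u (x - h) \<partial>lborel) \<le> emeasure lborel E * (C * ennreal (norm h))" for h
  proof -
    have "?u x - ?u (x - h) \<le> (\<integral>\<^sup>+z. indicator E z * (\<rho> (z - x) - \<rho> (z - x + h)) \<partial>lborel)" for x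
    proof -
      have "?u x - ?u (x - h) \<le> (\<integral>\<^sup>+z. \<rho> (z - x) * indicator E z - \<rho> (z - (x - h)) * indicator E z \<partial>lborel)"
        unfolding mollify_def
      proof (rule ennreal_minus_mono_nn_integral)
        show "(\<integral>\<^sup>+z. \<rho> (z - (x - h)) * indicator E z \<partial>lborel) < top"
          using mollify_le_1[OF assms(2,3) \<rho>, of "x - h"] unfolding mollify_def by (rule le_less_trans) simp
      qed auto
      also have "\<dots> = (\<integral>\<^sup>+z. indicator E z * (\<rho> (z - x) - \<rho> (z - x + h)) \<partial>lborel)"
        by (intro nn_integral_cong) (auto split: split_indicator simp: algebra_simps)
      finally show ?thesis .
    qed
    then have "(\<integral>\<^sup>+x. ?u x - ?u (x - h) \<partial>lborel) \<le> (\<integral>\<^sup>+x. \<integral>\<^sup>+z. indicator E z * (\<rho> (z - x) - \<rho> (z - x + h)) \<partial>lborel \<partial>lborel)"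
      by (rule nn_integral_mono)
    also have "\<dots> = (\<integral>\<^sup>+z. \<integral>\<^sup>+x. indicator E z * (\<rho> (z - x) - \<rho> (z - x + h)) \<partial>lborel \<partial>lborel)"
      by (rule lborel_pair.Fubini'[symmetric]) simp
    also have "\<dots> = (\<integral>\<^sup>+z. indicator E z * (\<integral>\<^sup>+x. \<rho> x - \<rho> (x + h) \<partial>lborel) \<partial>lborel)"
      by (simp add: nn_integral_cmult nn_integral_lborel_minus_left[of "\<lambda>w. \<rho> w - \<rho> (w + h)"])
    also have "\<dots> \<le> (\<integral>\<^sup>+z. indicator E z * (C * ennreal (norm h)) \<partial>lborel)"
      by (intro nn_integral_mono mult_left_mono lip) auto
    finally show ?thesis by (simp add: nn_integral_multc)
  qed
  have "variation k ?u = (\<integral>\<^sup>+x. \<integral>\<^sup>+h. k h * (?u x - ?u (x - h)) \<partial>lborel \<partial>lborel)"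
    unfolding variation_def
  proof (rule nn_integral_cong)
    fix x
    have "(\<integral>\<^sup>+h. k h * (?u x - ?u (x - h)) \<partial>lborel) = (\<integral>\<^sup>+y. k (x - y) * (?u x - ?u (x - (x - y))) \<partial>lborel)"
      by (rule nn_integral_lborel_minus_left[symmetric]) simp
    then show "(\<integral>\<^sup>+y. k (x - y) * (?u x - ?u y) \<partial>lborel) = (\<integral>\<^sup>+h. k h * (?u x - ?u (x - h)) \<partial>lborel)" by simp
  qed
  also have "\<dots> = (\<integral>\<^sup>+h. \<integral>\<^sup>+x. k h * (?u x - ?u (x - h)) \<partial>lborel \<partial>lborel)"
    by (rule lborel_pair.Fubini'[symmetric]) simp
  also have "\<dots> \<le> (\<integral>\<^sup>+h. k h * (emeasure lborel E * (C * ennreal (norm h))) \<partial>lborel)"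
    by (intro nn_integral_mono) (simp add: nn_integral_cmult mult_left_mono diff)
  also have "\<dots> = (\<integral>\<^sup>+h. emeasure lborel E * (C * (k h * ennreal (norm h))) \<partial>lborel)"
    by (simp add: mult_ac)
  also have "\<dots> = emeasure lborel E * (C * (\<integral>\<^sup>+h. k h * ennreal (norm h) \<partial>lborel))"
    by (simp add: nn_integral_cmult)
  finally show ?thesis .
qed

section \<open>Distance of the superlevel sets from the original set\<close>

text \<open>Chebyshev's inequality for the mollified indicator on the complement of
  \<open>E\<close>, where its integral is the interaction by evenness of \<rho>.\<close>

lemma superlevel_outside:
  fixes \<rho> :: "'a::euclidean_space \<Rightarrow> ennreal"
  assumes [measurable]: "\<rho> \<in> borel_measurable borel" "E \<in> sets borel" and "\<And>z. \<rho> (- z) = \<rho> z"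
  shows "ennreal t * emeasure lborel ({x. ennreal t < mollify \<rho> E x} - E) \<le> interaction \<rho> E (- E)"
proof -
  have "ennreal t * emeasure lborel ({x. ennreal t < mollify \<rho> E x} - E)
     = (\<integral>\<^sup>+x. ennreal t * indicator ({x. ennreal t < mollify \<rho> E x} - E) x \<partial>lborel)"
    by (simp add: nn_integral_cmult)
  also have "\<dots> \<le> (\<integral>\<^sup>+x. indicator (- E) x * mollify \<rho> E x \<partial>lborel)"
    by (intro nn_integral_mono) (auto split: split_indicator)
  also have "\<dots> = interaction \<rho> E (- E)"
    using assms by (simp add: interaction_mollify[symmetric] interaction_swap[of \<rho> E "- E"])
  finally show ?thesis .
qed

text \<open>Chebyshev's inequality on \<open>E\<close> for the mollified complement, which equals
  one minus the mollified set and so is at least \<open>1 - t\<close> off the superlevel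
  set.\<close>

lemma superlevel_inside:
  fixes \<rho> :: "'a::euclidean_space \<Rightarrow> ennreal"
  assumes [measurable]: "\<rho> \<in> borel_measurable borel" "E \<in> sets borel" and "\<And>z. \<rho> (- z) = \<rho> z"
    and \<rho>: "(\<integral>\<^sup>+z. \<rho> z \<partial>lborel) = 1" and t: "0 \<le> t" "t \<le> 1"
  shows "ennreal (1 - t) * emeasure lborel (E - {x. ennreal t < mollify \<rho> E x}) \<le> interaction \<rho> E (- E)"
proof -
  have *: "ennreal (1 - t) \<le> mollify \<rho> (- E) x" if "\<not> ennreal t < mollify \<rho> E x" for x
  proof -
    have "1 \<le> ennreal t + mollify \<rho> (- E) x"
      using that unfolding mollify_compl[OF assms(1,2) \<rho>, of x, symmetric] by (intro add_right_mono) simp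
    then have "1 - ennreal t \<le> mollify \<rho> (- E) x" by (auto simp: ennreal_minus_le_iff)
    then show ?thesis using ennreal_minus[of t 1] t by simp
  qed
  have "ennreal (1 - t) * emeasure lborel (E - {x. ennreal t < mollify \<rho> E x})
     = (\<integral>\<^sup>+x. ennreal (1 - t) * indicator (E - {x. ennreal t < mollify \<rho> E x}) x \<partial>lborel)"
    by (simp add: nn_integral_cmult)
  also have "\<dots> \<le> (\<integral>\<^sup>+x. indicator E x * mollify \<rho> (- E) x \<partial>lborel)"
    by (intro nn_integral_mono) (auto split: split_indicator simp: *)
  also have "\<dots> = interaction \<rho> E (- E)"
    using assms by (simp add: interaction_mollify)
  finally show ?thesis .
qed

section \<open>The ball density and its comparison with the kernel\<close>

definition ball_density :: "real \<Rightarrow> 'a::euclidean_space \<Rightarrow> ennreal" where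
  "ball_density \<epsilon> z = ennreal (1 / (unit_ball_vol (real DIM('a)) * \<epsilon> ^ DIM('a))) * indicator (ball 0 \<epsilon>) z"

lemma ball_density_measurable [measurable]: "ball_density \<epsilon> \<in> borel_measurable borel"
  unfolding ball_density_def[abs_def]
  by (intro borel_measurable_times_ennreal borel_measurable_const borel_measurable_indicator) auto

lemma ball_density_minus: "ball_density \<epsilon> (- z) = ball_density \<epsilon> z"
  by (simp add: ball_density_def indicator_def)

lemma nn_integral_ball_density:
  assumes "0 < \<epsilon>"
  shows "(\<integral>\<^sup>+z. ball_density \<epsilon> (z::'a::euclidean_space) \<partial>lborel) = 1"
proof -
  define W where "W = unit_ball_vol (real DIM('a)) * \<epsilon> ^ DIM('a)"
  have W: "0 < W" using assms by (simp add: W_def)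
  have "(\<integral>\<^sup>+z. ball_density \<epsilon> (z::'a) \<partial>lborel) = ennreal (1 / W) * ennreal W"
    unfolding ball_density_def W_def
    by (subst nn_integral_cmult_indicator) (auto simp: emeasure_ball assms less_imp_le)
  also have "\<dots> = 1" using W by (simp add: ennreal_mult[symmetric])
  finally show ?thesis .
qed

text \<open>A positive difference forces \<open>z\<close> into the annulus between the radii
  \<open>\<epsilon> - norm h\<close> and \<epsilon>. By Bernoulli's inequality this is at most the
  fraction \<open>d * norm h / \<epsilon>\<close> of the ball; if \<open>norm h > \<epsilon>\<close>
  the fraction exceeds \<open>1\<close> and bounds the whole ball.\<close>

lemma ball_density_lipschitz:
  fixes h :: "'a::euclidean_space"
  assumes "0 < \<epsilon>"
  shows "(\<integral>\<^sup>+z. ball_density \<epsilon> z - ball_density \<epsilon> (z + h) \<partial>lborel) \<le> ennreal (real DIM('a) / \<epsilon>) * ennreal (norm h)"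
proof -
  let ?w = "unit_ball_vol (real DIM('a))"
  define s where "s = norm h"
  have s: "0 \<le> s" by (simp add: s_def)
  have w: "0 < ?w" and W: "0 < ?w * \<epsilon> ^ DIM('a)" using assms by simp_all
  have "(\<integral>\<^sup>+z. ball_density \<epsilon> z - ball_density \<epsilon> (z + h) \<partial>lborel) \<le>
     (\<integral>\<^sup>+z. ennreal (1 / (?w * \<epsilon> ^ DIM('a))) * indicator (ball 0 \<epsilon> - ball 0 (\<epsilon> - s)) (z::'a) \<partial>lborel)"
  proof (rule nn_integral_mono)
    fix z :: 'a
    have "norm (z + h) < \<epsilon>" if "norm z < \<epsilon> - s"
      using norm_triangle_ineq[of z h] that by (simp add: s_def)
    then show "ball_density \<epsilon> z - ball_density \<epsilon> (z + h) \<le>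
       ennreal (1 / (?w * \<epsilon> ^ DIM('a))) * indicator (ball 0 \<epsilon> - ball 0 (\<epsilon> - s)) z"
      by (auto simp: ball_density_def split: split_indicator)
  qed
  also have "\<dots> = ennreal (1 / (?w * \<epsilon> ^ DIM('a))) * emeasure lborel (ball (0::'a) \<epsilon> - ball 0 (\<epsilon> - s))"
    by (rule nn_integral_cmult_indicator) auto
  also have "\<dots> \<le> ennreal (1 / (?w * \<epsilon> ^ DIM('a))) * ennreal (?w * \<epsilon> ^ DIM('a) * (real DIM('a) * s / \<epsilon>))"
  proof (rule mult_left_mono)
    show "emeasure lborel (ball (0::'a) \<epsilon> - ball 0 (\<epsilon> - s)) \<le> ennreal (?w * \<epsilon> ^ DIM('a) * (real DIM('a) * s / \<epsilon>))"
    proof (cases "s \<le> \<epsilon>")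
      case True
      have "emeasure lborel (ball (0::'a) \<epsilon> - ball 0 (\<epsilon> - s)) = ennreal (?w * \<epsilon> ^ DIM('a)) - ennreal (?w * (\<epsilon> - s) ^ DIM('a))"
        using True assms s by (subst emeasure_Diff) (auto simp: emeasure_ball)
      also have "\<dots> = ennreal (?w * \<epsilon> ^ DIM('a) * (1 - (1 - s / \<epsilon>) ^ DIM('a)))"
      proof -
        have *: "(\<epsilon> - s) ^ DIM('a) = \<epsilon> ^ DIM('a) * (1 - s / \<epsilon>) ^ DIM('a)"
          using assms by (simp add: power_mult_distrib[symmetric] right_diff_distrib)
        have "0 \<le> ?w * (\<epsilon> - s) ^ DIM('a)" using True w by simp
        then show ?thesis by (simp add: ennreal_minus) (simp add: * algebra_simps)
      qed
      also have "\<dots> \<le> ennreal (?w * \<epsilon> ^ DIM('a) * (real DIM('a) * s / \<epsilon>))"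
      proof (intro ennreal_leI mult_left_mono)
        have "1 + real DIM('a) * (- (s / \<epsilon>)) \<le> (1 + - (s / \<epsilon>)) ^ DIM('a)"
          using True assms by (intro Bernoulli_inequality) (simp add: s_def)
        then show "1 - (1 - s / \<epsilon>) ^ DIM('a) \<le> real DIM('a) * s / \<epsilon>" by simp
      qed (use W in simp)
      finally show ?thesis .
    next
      case False
      have "emeasure lborel (ball (0::'a) \<epsilon> - ball 0 (\<epsilon> - s)) \<le> emeasure lborel (ball (0::'a) \<epsilon>)"
        by (intro emeasure_mono) auto
      also have "\<dots> = ennreal (?w * \<epsilon> ^ DIM('a) * 1)" using assms by (simp add: emeasure_ball)
      also have "\<dots> \<le> ennreal (?w * \<epsilon> ^ DIM('a) * (real DIM('a) * s / \<epsilon>))"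
      proof (intro ennreal_leI mult_left_mono)
        have "1 * s \<le> real DIM('a) * s" by (intro mult_right_mono) (auto simp: s_def Suc_leI)
        then have "\<epsilon> \<le> real DIM('a) * s" using False by linarith
        then show "1 \<le> real DIM('a) * s / \<epsilon>" using assms by simp
      qed (use W in simp)
      finally show ?thesis .
    qed
  qed simp
  also have "\<dots> = ennreal (real DIM('a) / \<epsilon>) * ennreal (norm h)"
  proof -
    have cancel: "1 / W * (W * x) = x" if "0 < W" for W x :: real using that by simp
    have "ennreal (1 / (?w * \<epsilon> ^ DIM('a))) * ennreal (?w * \<epsilon> ^ DIM('a) * (real DIM('a) * s / \<epsilon>)) = ennreal (real DIM('a) * s / \<epsilon>)"
      unfolding ennreal_mult'[symmetric, OF divide_nonneg_nonneg[OF zero_le_one less_imp_le[OF W]]] cancel[OF W] ..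
    then show ?thesis using assms by (simp add: ennreal_mult[symmetric] s_def)
  qed
  finally show ?thesis .
qed

text \<open>For \<open>\<sigma> < 1\<close> the new exponent is negative, so the shell formula
  applies down to radius \<open>0\<close>. This is how the bound \<open>\<sigma>' < 1\<close>
  enters.\<close>

lemma kern_times_norm:
  fixes h :: "'a::euclidean_space"
  shows "kern \<sigma> S h * ennreal (norm h) = kern (\<sigma> - 1) S h"
proof (cases "h = 0")
  case True
  then show ?thesis by (simp add: kern_def)
next
  case False
  have "norm h powr (real DIM('a) + \<sigma>) = norm h powr ((real DIM('a) + (\<sigma> - 1)) + 1)" by simp
  also have "\<dots> = norm h powr (real DIM('a) + (\<sigma> - 1)) * norm h"
    using False by (subst powr_add) simp
  finally have "1 / norm h powr (real DIM('a) + \<sigma>) * norm h = 1 / norm h powr (real DIM('a) + (\<sigma> - 1))"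
    using False by simp
  then show ?thesis by (simp add: kern_def mult.assoc ennreal_mult[symmetric])
qed

text \<open>For \<open>0 < norm z < \<epsilon> \<le> 1\<close> and \<open>\<sigma> \<ge> 0\<close>
  the power of \<open>norm z\<close> in the kernel is at most \<open>norm z ^ d\<close>, hence at
  most \<open>\<epsilon> ^ d\<close>. So the kernel dominates a multiple of the density.\<close>

lemma interaction_ball_density_le:
  fixes E :: "'a::euclidean_space set"
  assumes [measurable]: "E \<in> sets borel" and "0 < \<epsilon>" "\<epsilon> \<le> 1" "0 \<le> \<sigma>"
  shows "interaction (ball_density \<epsilon>) E (- E) \<le> ennreal (1 / unit_ball_vol (real DIM('a))) * interaction (kern \<sigma> {0..<\<epsilon>}) E (- E)"
proof -
  let ?w = "unit_ball_vol (real DIM('a))"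
  \<comment> \<open>At \<open>z = 0\<close> the kernel has the junk value \<open>0\<close>, but \<open>x \<noteq> y\<close> for \<open>x \<in> E\<close>, \<open>y \<notin> E\<close>.\<close>
  have *: "ball_density \<epsilon> z \<le> ennreal (1 / ?w) * kern \<sigma> {0..<\<epsilon>} z" if "z \<noteq> 0" for z :: 'a
  proof (cases "norm z < \<epsilon>")
    case True
    have "norm z powr (real DIM('a) + \<sigma>) \<le> norm z powr real DIM('a)"
      using True assms that by (intro powr_mono') auto
    also have "\<dots> = norm z ^ DIM('a)" using that by (simp add: powr_realpow)
    also have "\<dots> \<le> \<epsilon> ^ DIM('a)" using True by (intro power_mono) auto
    finally have "1 / \<epsilon> ^ DIM('a) \<le> 1 / norm z powr (real DIM('a) + \<sigma>)"
      using that assms by (intro divide_left_mono mult_pos_pos) auto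
    then have "1 / ?w * (1 / \<epsilon> ^ DIM('a)) \<le> 1 / ?w * (1 / norm z powr (real DIM('a) + \<sigma>))"
      by (intro mult_left_mono) auto
    then show ?thesis using True assms
      by (simp add: ball_density_def kern_def ennreal_mult[symmetric] ennreal_leI)
  qed (simp add: ball_density_def)
  have "interaction (ball_density \<epsilon>) E (- E) \<le> (\<integral>\<^sup>+x. \<integral>\<^sup>+y. ennreal (1 / ?w) * (indicator E x * indicator (- E) y * kern \<sigma> {0..<\<epsilon>} (x - y)) \<partial>lborel \<partial>lborel)"
    unfolding interaction_def by (intro nn_integral_mono) (auto split: split_indicator intro: *)
  also have "\<dots> = ennreal (1 / ?w) * interaction (kern \<sigma> {0..<\<epsilon>}) E (- E)"
    unfolding interaction_def by (simp add: nn_integral_cmult)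
  finally show ?thesis .
qed

text \<open>The finite energy on \<open>{0..<1}\<close> dominates, and the kernels tend to
  \<open>0\<close> pointwise: off the origin they vanish eventually, at the origin always.\<close>

lemma interaction_kern_shrinking_shell:
  fixes E :: "'a::euclidean_space set"
  assumes [measurable]: "E \<in> sets borel" and fin: "interaction (kern \<sigma> {0..<1}) E (- E) < \<infinity>"
  shows "(\<lambda>n. interaction (kern \<sigma> {0..<1 / real (Suc n)}) E (- E)) \<longlonglongrightarrow> 0"
proof -
  have "(\<lambda>n. interaction (kern \<sigma> {0..<1 / real (Suc n)}) E (- E)) \<longlonglongrightarrow> interaction (\<lambda>_. 0) E (- E)"
  proof (rule interaction_dominated_convergence[where w="kern \<sigma> {0..<1}"])
    fix n and z :: 'a
    show "kern \<sigma> {0..<1 / real (Suc n)} z \<le> kern \<sigma> {0..<1} z"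
    proof (rule kern_mono)
      have "1 / real (Suc n) \<le> 1" by simp
      then show "{0..<1 / real (Suc n)} \<subseteq> {0..<1::real}" by (simp add: ivl_subset)
    qed
  next
    fix z :: 'a
    show "(\<lambda>n. kern \<sigma> {0..<1 / real (Suc n)} z) \<longlonglongrightarrow> 0"
    proof (cases "z = 0")
      case False
      have "eventually (\<lambda>n. 1 / real (Suc n) < norm z) sequentially"
        using LIMSEQ_inverse_real_of_nat False by (intro order_tendstoD) (auto simp: inverse_eq_divide)
      then have "eventually (\<lambda>n. kern \<sigma> {0..<1 / real (Suc n)} z = 0) sequentially"
        by eventually_elim (simp add: kern_def)
      then show ?thesis by (rule tendsto_eventually)
    qed (simp add: kern_def)
  qed (use fin in auto)
  then show ?thesis by (simp add: interaction_def)
qed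

section \<open>Choice of a level and approximation by sets of higher fractional regularity\<close>

lemma variation_add_cmult:
  fixes k k' :: "'a::euclidean_space \<Rightarrow> ennreal"
  assumes [measurable]: "k \<in> borel_measurable borel" "k' \<in> borel_measurable borel" "u \<in> borel_measurable borel"
  shows "variation (\<lambda>z. k z + c * k' z) u = variation k u + c * variation k' u"
  unfolding variation_def by (simp add: distrib_right nn_integral_add nn_integral_cmult mult.assoc)

lemma interaction_add_cmult:
  fixes k k' :: "'a::euclidean_space \<Rightarrow> ennreal"
  assumes [measurable]: "k \<in> borel_measurable borel" "k' \<in> borel_measurable borel" "A \<in> sets borel" "B \<in> sets borel"
  shows "interaction (\<lambda>z. k z + c * k' z) A B = interaction k A B + c * interaction k' A B"
  unfolding interaction_def by (simp add: distrib_left nn_integral_add nn_integral_cmult mult_ac)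

text \<open>If all levels between \<delta> and \<open>1 - \<delta>\<close> exceeded
  \<open>b\<close>, the coarea inequality would make the variation at least
  \<open>b * (1 - 2 * \<delta>)\<close>. Levels stay away from \<open>0\<close> and \<open>1\<close>
  because the distance estimates carry the factors \<open>t\<close> and
  \<open>1 - t\<close>.\<close>

lemma exists_good_level:
  fixes k :: "'a::euclidean_space \<Rightarrow> ennreal"
  assumes [measurable]: "k \<in> borel_measurable borel" "u \<in> borel_measurable borel" and u: "\<And>x. u x \<le> 1"
    and \<delta>: "0 < \<delta>" "\<delta> < 1 / 2" and var: "variation k u \<le> ennreal a" and a: "0 \<le> a" "a < b * (1 - 2 * \<delta>)"
  obtains t where "\<delta> < t" "t < 1 - \<delta>" "interaction k {x. ennreal t < u x} (- {x. ennreal t < u x}) \<le> ennreal b"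
proof -
  let ?f = "\<lambda>t. interaction k {x. ennreal t < u x} (- {x. ennreal t < u x})"
  have "\<exists>t. \<delta> < t \<and> t < 1 - \<delta> \<and> ?f t \<le> ennreal b"
  proof (rule ccontr)
    assume "\<not> ?thesis"
    then have *: "ennreal b \<le> ?f t" if "\<delta> < t" "t < 1 - \<delta>" for t
      using that by (meson le_cases)
    have "0 < b * (1 - 2 * \<delta>)" using a by linarith
    then have b: "0 < b" using \<delta> by (simp add: zero_less_mult_iff)
    have "ennreal (b * (1 - 2 * \<delta>)) = (\<integral>\<^sup>+t. ennreal b * indicator {\<delta><..<1 - \<delta>} t \<partial>lborel)"
      using \<delta> b by (simp add: nn_integral_cmult ennreal_mult[symmetric])
    also have "\<dots> \<le> (\<integral>\<^sup>+t. ?f t * indicator {0<..} t \<partial>lborel)"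
      by (intro nn_integral_mono) (use * \<delta> in \<open>auto split: split_indicator\<close>)
    also have "\<dots> \<le> ennreal a" using coarea_le[OF assms(1,2) u] var by (rule order_trans)
    finally show False using a by (simp add: ennreal_le_iff)
  qed
  then show ?thesis using that by blast
qed

text \<open>Provides sets to which the constant-sequence limsup estimate at radius \<open>0\<close>
  applies, near \<open>E\<close> and with almost no increase of the \<sigma>-perimeter.\<close>

lemma smoother_set_approximation:
  fixes E :: "'a::euclidean_space set"
  assumes [measurable]: "E \<in> sets borel" and Efin: "emeasure lborel E < \<infinity>"
    and \<sigma>: "0 \<le> \<sigma>" "\<sigma>' < 1" and P: "interaction (kern \<sigma> {0..<1}) E (- E) < \<infinity>" and e: "0 < e"
  obtains F where "F \<in> sets borel" "emeasure lborel F < \<infinity>" "measure lborel (sym_diff F E) < e"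
    "interaction (kern \<sigma> {0..<1}) F (- F) \<le> interaction (kern \<sigma> {0..<1}) E (- E) + ennreal e"
    "interaction (kern \<sigma>' {0..<1}) F (- F) < \<infinity>"
proof -
  let ?w = "unit_ball_vol (real DIM('a))"
  let ?k = "kern \<sigma> {0..<1} :: 'a \<Rightarrow> ennreal" and ?k' = "kern \<sigma>' {0..<1} :: 'a \<Rightarrow> ennreal"
  obtain p where p: "interaction ?k E (- E) = ennreal p" "0 \<le> p"
    using P by (metis ennreal_cases infinity_ennreal_def less_irrefl)
  \<comment> \<open>The choice gives \<open>\<delta> * (1 + 2 * (p + e)) = e / 2 < e\<close>, which
    is what \<open>p + \<delta> < (p + e) * (1 - 2 * \<delta>)\<close> asks for after
    expansion.\<close>
  define \<delta> where "\<delta> = e / (2 * (1 + 2 * (p + e)))"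
  have D: "0 < 2 * (1 + 2 * (p + e))" using p e by simp
  have \<delta>: "0 < \<delta>" "\<delta> < 1 / 2" using e D p by (auto simp: \<delta>_def divide_simps)
  have "\<delta> * (1 + 2 * (p + e)) = e / 2" using D by (simp add: \<delta>_def field_simps)
  then have level: "p + \<delta> < (p + e) * (1 - 2 * \<delta>)" using e by (simp add: algebra_simps)
  \<comment> \<open>The factor \<open>?w\<close> cancels the constant of the kernel comparison, and
    \<delta> cancels the lower bound for \<open>t\<close> and \<open>1 - t\<close>. Each of
    \<open>F - E\<close> and \<open>E - F\<close> then has measure at most
    \<open>e / 3\<close>.\<close>
  have "0 < ?w * (\<delta> * e / 3)" using \<delta> e by (intro mult_pos_pos divide_pos_pos unit_ball_vol_pos) auto
  then have "eventually (\<lambda>n. interaction (kern \<sigma> {0..<1 / real (Suc n)}) E (- E) < ennreal (?w * (\<delta> * e / 3))) sequentially"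
    using interaction_kern_shrinking_shell[OF assms(1) P] by (intro order_tendstoD) (auto simp: ennreal_zero_less_mult_iff)
  then obtain n where n: "interaction (kern \<sigma> {0..<1 / real (Suc n)}) E (- E) < ennreal (?w * (\<delta> * e / 3))"
    by (auto simp: eventually_sequentially)
  define \<epsilon> where "\<epsilon> = 1 / real (Suc n)"
  have \<epsilon>: "0 < \<epsilon>" "\<epsilon> \<le> 1" by (auto simp: \<epsilon>_def)
  let ?\<rho> = "ball_density \<epsilon> :: 'a \<Rightarrow> ennreal"
  define u where "u = mollify ?\<rho> E"
  have [measurable]: "u \<in> borel_measurable borel" by (simp add: u_def)
  have R: "interaction ?\<rho> E (- E) \<le> ennreal (\<delta> * e / 3)"
  proof -
    have "interaction ?\<rho> E (- E) \<le> ennreal (1 / ?w) * interaction (kern \<sigma> {0..<\<epsilon>}) E (- E)"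
      by (rule interaction_ball_density_le[OF assms(1) \<epsilon> \<sigma>(1)])
    also have "\<dots> \<le> ennreal (1 / ?w) * ennreal (?w * (\<delta> * e / 3))"
      using n by (intro mult_left_mono) (auto simp: \<epsilon>_def)
    also have "\<dots> = ennreal (\<delta> * e / 3)"
    proof -
      have "?w \<noteq> 0" using unit_ball_vol_pos[of "real DIM('a)"] by linarith
      then have "1 / ?w * (?w * (\<delta> * e / 3)) = \<delta> * e / 3" by simp
      then show ?thesis using \<delta> e by (subst ennreal_mult[symmetric]) simp_all
    qed
    finally show ?thesis .
  qed
  \<comment> \<open>With \<epsilon> now fixed, the Lipschitz estimate makes the variation for the
    exponent \<open>\<sigma>'\<close> finite, however large \<open>1 / \<epsilon>\<close>
    is.\<close>
  have "variation ?k' u \<le> emeasure lborel E * (ennreal (real DIM('a) / \<epsilon>) * (\<integral>\<^sup>+h. ?k' h * ennreal (norm h) \<partial>lborel))"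
    unfolding u_def by (rule variation_mollify_lipschitz)
      (auto intro: nn_integral_ball_density ball_density_lipschitz \<epsilon>)
  also have "(\<integral>\<^sup>+h. ?k' h * ennreal (norm h) \<partial>lborel) = ennreal (gamma_const TYPE('a) (\<sigma>' - 1) 1 - gamma_const TYPE('a) (\<sigma>' - 1) 0)"
    unfolding kern_times_norm using \<sigma> by (intro nn_integral_kern_shell) auto
  also have "emeasure lborel E * (ennreal (real DIM('a) / \<epsilon>) * \<dots>) < \<infinity>"
    using Efin by (simp add: ennreal_mult_less_top)
  finally obtain q where q: "variation ?k' u = ennreal q" "0 \<le> q"
    by (metis ennreal_cases infinity_ennreal_def less_irrefl)
  \<comment> \<open>Adding a small multiple of the \<open>\<sigma>'\<close>-kernel lets a single choice of the level control the
    \<open>\<sigma>\<close>-perimeter sharply and keep the \<open>\<sigma>'\<close>-perimeter finite.\<close>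
  define \<eta> where "\<eta> = \<delta> / (q + 1)"
  have \<eta>: "0 < \<eta>" "\<eta> * q \<le> \<delta>" using q \<delta> by (auto simp: \<eta>_def divide_simps algebra_simps)
  let ?kk = "\<lambda>z. ?k z + ennreal \<eta> * ?k' z"
  have "variation ?kk u = variation ?k u + ennreal \<eta> * variation ?k' u" by (rule variation_add_cmult) auto
  also have "\<dots> \<le> ennreal p + ennreal \<eta> * ennreal q"
    unfolding p(1)[symmetric] q(1)[symmetric] u_def
    by (intro add_mono variation_mollify_le nn_integral_ball_density \<epsilon>) auto
  also have "\<dots> = ennreal (p + \<eta> * q)" using p q \<eta> by (simp add: ennreal_mult)
  also have "\<dots> \<le> ennreal (p + \<delta>)" using \<eta> by (intro ennreal_leI) simp
  finally have var: "variation ?kk u \<le> ennreal (p + \<delta>)" .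
  have u1: "u x \<le> 1" for x unfolding u_def by (intro mollify_le_1 nn_integral_ball_density \<epsilon>) auto
  obtain t where t: "\<delta> < t" "t < 1 - \<delta>" and good: "interaction ?kk {x. ennreal t < u x} (- {x. ennreal t < u x}) \<le> ennreal (p + e)"
    by (rule exists_good_level[of ?kk u \<delta> "p + \<delta>" "p + e"]) (use u1 \<delta> var p level in auto)
  define F where "F = {x. ennreal t < u x}"
  have [measurable]: "F \<in> sets borel" unfolding F_def by measurable
  have good: "interaction ?k F (- F) + ennreal \<eta> * interaction ?k' F (- F) \<le> ennreal (p + e)"
    using good unfolding F_def[symmetric] by (subst (asm) interaction_add_cmult) auto
  have shrink: "X \<le> ennreal (e / 3)" if "ennreal \<delta> * X \<le> ennreal (\<delta> * e / 3)" for X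
  proof -
    have "ennreal (\<delta> * e / 3) = ennreal \<delta> * ennreal (e / 3)" using \<delta> e by (simp add: ennreal_mult[symmetric])
    with that show ?thesis using \<delta> by (simp add: ennreal_mult_le_mult_iff)
  qed
  have out: "emeasure lborel (F - E) \<le> ennreal (e / 3)"
  proof (rule shrink)
    have "ennreal \<delta> * emeasure lborel (F - E) \<le> ennreal t * emeasure lborel (F - E)"
      using t by (intro mult_right_mono ennreal_leI) auto
    also have "\<dots> \<le> interaction ?\<rho> E (- E)"
      unfolding F_def u_def by (rule superlevel_outside) (auto simp: ball_density_minus)
    finally show "ennreal \<delta> * emeasure lborel (F - E) \<le> ennreal (\<delta> * e / 3)" using R by (rule order_trans)
  qed
  have ins: "emeasure lborel (E - F) \<le> ennreal (e / 3)"
  proof (rule shrink)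
    have "ennreal \<delta> * emeasure lborel (E - F) \<le> ennreal (1 - t) * emeasure lborel (E - F)"
      using t by (intro mult_right_mono ennreal_leI) auto
    also have "\<dots> \<le> interaction ?\<rho> E (- E)"
      unfolding F_def u_def by (rule superlevel_inside) (use t \<delta> \<epsilon> in \<open>auto simp: ball_density_minus nn_integral_ball_density\<close>)
    finally show "ennreal \<delta> * emeasure lborel (E - F) \<le> ennreal (\<delta> * e / 3)" using R by (rule order_trans)
  qed
  show ?thesis
  proof (rule that[of F])
    have "emeasure lborel F \<le> emeasure lborel (E \<union> (F - E))" by (intro emeasure_mono) auto
    also have "\<dots> \<le> emeasure lborel E + emeasure lborel (F - E)" by (intro emeasure_subadditive) auto
    also have "\<dots> \<le> emeasure lborel E + ennreal (e / 3)" by (intro add_left_mono out)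
    also have "\<dots> < \<infinity>" using Efin by simp
    finally show "emeasure lborel F < \<infinity>" .
    have "emeasure lborel (sym_diff F E) \<le> emeasure lborel (F - E) + emeasure lborel (E - F)"
      by (intro emeasure_subadditive) auto
    also have "\<dots> \<le> ennreal (e / 3) + ennreal (e / 3)" by (intro add_mono out ins)
    also have "\<dots> = ennreal (2 * e / 3)" using e by (simp flip: ennreal_plus)
    finally have "measure lborel (sym_diff F E) \<le> 2 * e / 3"
      unfolding measure_def by (rule enn2real_leI[rotated]) (use e in simp)
    then show "measure lborel (sym_diff F E) < e" using e by simp
    have "interaction ?k F (- F) \<le> interaction ?k F (- F) + ennreal \<eta> * interaction ?k' F (- F)" by simp
    also note good
    also have "ennreal (p + e) = interaction ?k E (- E) + ennreal e" using p e by simp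
    finally show "interaction ?k F (- F) \<le> interaction ?k E (- E) + ennreal e" .
    have "ennreal \<eta> * interaction ?k' F (- F) \<le> interaction ?k F (- F) + ennreal \<eta> * interaction ?k' F (- F)" by simp
    also note good
    also have "ennreal (p + e) < \<infinity>" by simp
    finally show "interaction ?k' F (- F) < \<infinity>" using \<eta> by (auto simp: ennreal_mult_less_top)
  qed simp
qed

section \<open>Recovery sequences\<close>

text \<open>Finiteness of \<open>b m\<close> gives \<open>b m < b m + 1 / (m + 1)\<close>, so from
  some index \<open>N m\<close> on the \<open>m\<close>-th sequence stays below the latter. At
  \<open>n\<close> the largest admissible \<open>m\<close> is taken.\<close>

lemma diagonal_limsup:
  fixes a :: "nat \<Rightarrow> nat \<Rightarrow> ereal"
  assumes "\<And>m. limsup (\<lambda>n. a n m) \<le> b m" and b: "\<And>m. \<bar>b m\<bar> \<noteq> \<infinity>" "b \<longlonglongrightarrow> L"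
  obtains \<phi> where "filterlim \<phi> at_top sequentially" "limsup (\<lambda>n. a n (\<phi> n)) \<le> L"
proof -
  define c where "c m = b m + ereal (1 / real (Suc m))" for m
  have "b m < c m" for m using b(1)[of m] by (cases "b m") (auto simp: c_def)
  then have "limsup (\<lambda>n. a n m) < c m" for m using assms(1) by (rule le_less_trans[rotated])
  then have "eventually (\<lambda>n. a n m < c m) sequentially" for m by (rule Limsup_lessD)
  then have "\<forall>m. \<exists>N. \<forall>n\<ge>N. a n m < c m" by (simp add: eventually_sequentially)
  then obtain N where N: "\<And>m n. N m \<le> n \<Longrightarrow> a n m < c m" by metis
  \<comment> \<open>The condition \<open>m \<le> n\<close> keeps the set finite, and
    \<open>0\<close> belongs to it once \<open>N 0 \<le> n\<close>, so the maximum is meaningful for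
    large \<open>n\<close>. Every \<open>m\<close> is eventually admissible, hence the maxima tend
    to infinity.\<close>
  define S where "S n = {m. m \<le> n \<and> N m \<le> n}" for n
  define \<phi> where "\<phi> n = Max (S n)" for n
  have fin: "finite (S n)" for n by (simp add: S_def)
  have lim: "filterlim \<phi> at_top sequentially"
    unfolding filterlim_at_top
  proof
    fix M
    have "M \<le> \<phi> n" if "max M (N M) \<le> n" for n
      unfolding \<phi>_def using that by (intro Max_ge fin) (simp add: S_def)
    then show "eventually (\<lambda>n. M \<le> \<phi> n) sequentially"
      by (rule eventually_mono[OF eventually_ge_at_top[of "max M (N M)"]])
  qed
  have ac: "a n (\<phi> n) \<le> c (\<phi> n)" if "N 0 \<le> n" for n
  proof -
    have "0 \<in> S n" using that by (simp add: S_def)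
    then have "\<phi> n \<in> S n" unfolding \<phi>_def using fin by (intro Max_in) auto
    then show ?thesis using N by (simp add: S_def less_imp_le)
  qed
  have "(\<lambda>m. ereal (1 / real (Suc m))) \<longlonglongrightarrow> ereal 0"
    using LIMSEQ_inverse_real_of_nat by (intro tendsto_ereal) (simp add: inverse_eq_divide)
  then have "c \<longlonglongrightarrow> L + ereal 0"
    unfolding c_def by (intro tendsto_add_ereal_general b) auto
  then have "(\<lambda>n. c (\<phi> n)) \<longlonglongrightarrow> L" using lim by (simp add: filterlim_compose)
  then have "limsup (\<lambda>n. c (\<phi> n)) = L" by (intro lim_imp_Limsup) auto
  moreover have "limsup (\<lambda>n. a n (\<phi> n)) \<le> limsup (\<lambda>n. c (\<phi> n))"
    by (intro Limsup_mono) (use ac in \<open>auto simp: eventually_sequentially\<close>)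
  ultimately show ?thesis using that lim by simp
qed

text \<open>The constant sequence works unless the radius is \<open>0\<close>, the limit energy is finite and all
  \<open>\<sigma>'\<close>-perimeters with \<open>\<sigma>' > \<sigma>0\<close> are infinite; this forces \<open>\<sigma>0 \<ge> 0\<close>.\<close>

lemma J_hat_recovery_sequence:
  fixes E :: "'a::euclidean_space set"
  assumes E: "E \<in> sets borel" "emeasure lborel E < \<infinity>"
    and \<sigma>: "\<sigma> \<longlonglongrightarrow> \<sigma>0" "\<And>n. - real DIM('a) < \<sigma> n" "- real DIM('a) < \<sigma>0" "\<sigma>0 < 1"
    and r: "r \<longlonglongrightarrow> r0" "\<And>n. 0 \<le> r n" "0 \<le> r0"
  obtains En where "\<And>n. En n \<in> sets borel" "\<And>n. emeasure lborel (En n) < \<infinity>"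
    "(\<lambda>n. measure lborel (sym_diff (En n) E)) \<longlonglongrightarrow> 0"
    "limsup (\<lambda>n. J_hat (\<sigma> n) (r n) (En n)) \<le> J_hat \<sigma>0 r0 E"
proof (cases "limsup (\<lambda>n. J_hat (\<sigma> n) (r n) E) \<le> J_hat \<sigma>0 r0 E")
  case True
  then show ?thesis by (intro that[of "\<lambda>_. E"]) (use E in auto)
next
  case False
  have r0: "r0 = 0" using J_hat_limsup_pos_radius[OF E \<sigma>(1-3) r(1)] False r(3) by force
  have const: "\<not> interaction (kern \<sigma>' {0..<1}) E (- E) < \<infinity>" if "\<sigma>0 < \<sigma>'" for \<sigma>'
    using J_hat_limsup_zero_radius[OF E \<sigma>(1-3) that _ r(2)] False r0 by auto
  \<comment> \<open>For negative \<open>\<sigma>0\<close> the exponent \<open>\<sigma>0 / 2\<close>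
    is larger but still negative, and its perimeter of range \<open>1\<close> is finite, against
    \<open>const\<close>.\<close>
  have \<sigma>0: "0 \<le> \<sigma>0"
  proof (rule ccontr)
    assume "\<not> 0 \<le> \<sigma>0"
    then have *: "- real DIM('a) < \<sigma>0 / 2" "0 < (0::real) \<or> (0::real) = 0 \<and> \<sigma>0 / 2 < 0" "\<sigma>0 < \<sigma>0 / 2"
      using \<sigma>(3) by auto
    obtain b where "interaction (kern (\<sigma>0 / 2) {0..<1}) E (- E) = ennreal b"
      using J_hat_trunc_split[OF E *(1,2), of 1] by auto
    then show False using const[OF *(3)] by simp
  qed
  let ?P = "\<lambda>F. interaction (kern \<sigma>0 {0..<1}) F (- F)"
  obtain a where a: "J_hat \<sigma>0 1 E = ereal a" using J_hat_finite[OF E \<sigma>(3), of 1] by auto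
  have split: "J_hat \<sigma>0 0 F = J_hat \<sigma>0 1 F + enn2ereal (?P F)"
    if "F \<in> sets borel" "emeasure lborel F < \<infinity>" for F :: "'a set"
    using J_hat_split[OF that \<sigma>(3), of 0 1] by simp
  \<comment> \<open>An infinite perimeter would make the limit energy infinite, and then the
    constant sequence could not fail.\<close>
  have P: "?P E < \<infinity>"
  proof (rule ccontr)
    assume "\<not> ?P E < \<infinity>"
    then have "?P E = top" by (metis infinity_ennreal_def less_top)
    then show False using False r0 split[OF E] a by simp
  qed
  then obtain p where p: "?P E = ennreal p" "0 \<le> p"
    by (metis ennreal_cases infinity_ennreal_def less_irrefl)
  define e where "e m = 1 / real (Suc m)" for m
  have e: "0 < e m" for m by (simp add: e_def)
  have e0: "e \<longlonglongrightarrow> 0" unfolding e_def using LIMSEQ_inverse_real_of_nat by (simp add: inverse_eq_divide)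
  define \<sigma>' where "\<sigma>' = (\<sigma>0 + 1) / 2"
  have \<sigma>': "\<sigma>0 < \<sigma>'" "\<sigma>' < 1" using \<sigma>(4) by (auto simp: \<sigma>'_def)
  have "\<exists>F. F \<in> sets borel \<and> emeasure lborel F < \<infinity> \<and> measure lborel (sym_diff F E) < e m \<and>
    ?P F \<le> ?P E + ennreal (e m) \<and> interaction (kern \<sigma>' {0..<1}) F (- F) < \<infinity>" for m
    using smoother_set_approximation[OF E \<sigma>0 \<sigma>'(2) P e] by metis
  then obtain F where F: "\<And>m. F m \<in> sets borel" "\<And>m. emeasure lborel (F m) < \<infinity>"
    "\<And>m. measure lborel (sym_diff (F m) E) < e m" "\<And>m. ?P (F m) \<le> ?P E + ennreal (e m)"
    "\<And>m. interaction (kern \<sigma>' {0..<1}) (F m) (- F m) < \<infinity>" by metis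
  have Flim: "(\<lambda>m. measure lborel (sym_diff (F m) E)) \<longlonglongrightarrow> 0"
    by (rule tendsto_sandwich[OF _ _ tendsto_const e0]) (use F(3) in \<open>auto intro!: always_eventually less_imp_le\<close>)
  \<comment> \<open>The perimeter bound for \<open>F m\<close> makes \<open>b m\<close> a finite
    upper bound for the energy of \<open>F m\<close> at radius \<open>0\<close>. It converges
    because its first term is taken at the fixed radius \<open>1\<close>.\<close>
  define b where "b m = J_hat \<sigma>0 1 (F m) + ereal (p + e m)" for m
  have bfin: "\<bar>b m\<bar> \<noteq> \<infinity>" for m
  proof -
    obtain x where "J_hat \<sigma>0 1 (F m) = ereal x" using J_hat_finite[OF F(1,2) \<sigma>(3), of 1] by auto
    then show ?thesis by (simp add: b_def)
  qed
  have "b \<longlonglongrightarrow> J_hat \<sigma>0 1 E + ereal (p + 0)"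
    unfolding b_def
    by (intro tendsto_add_ereal_general tendsto_ereal tendsto_add tendsto_const e0
       J_hat_tendsto[OF E F(1,2) Flim tendsto_const \<sigma>(3,3)]) (auto simp: a)
  also have "J_hat \<sigma>0 1 E + ereal (p + 0) = J_hat \<sigma>0 0 E" using split[OF E] p by simp
  finally have blim: "b \<longlonglongrightarrow> J_hat \<sigma>0 0 E" .
  have lsup: "limsup (\<lambda>n. J_hat (\<sigma> n) (r n) (F m)) \<le> b m" for m
  proof -
    have "limsup (\<lambda>n. J_hat (\<sigma> n) (r n) (F m)) \<le> J_hat \<sigma>0 0 (F m)"
      by (rule J_hat_limsup_zero_radius[OF F(1,2) \<sigma>(1-3) \<sigma>'(1) F(5) r(2)])
    also have "\<dots> \<le> b m"
    proof -
      have "?P (F m) \<le> ennreal (p + e m)" using F(4)[of m] p e[of m] by (simp add: less_imp_le)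
      then have "enn2ereal (?P (F m)) \<le> enn2ereal (ennreal (p + e m))" by (simp only: less_eq_ennreal.rep_eq[symmetric])
      also have "\<dots> = ereal (p + e m)" using p e[of m] by (simp add: enn2ereal_ennreal del: ennreal_plus)
      finally show ?thesis unfolding split[OF F(1,2)] b_def by (rule add_left_mono)
    qed
    finally show ?thesis .
  qed
  obtain \<phi> where \<phi>: "filterlim \<phi> at_top sequentially"
      "limsup (\<lambda>n. J_hat (\<sigma> n) (r n) (F (\<phi> n))) \<le> J_hat \<sigma>0 0 E"
    by (rule diagonal_limsup[of "\<lambda>n m. J_hat (\<sigma> n) (r n) (F m)", OF lsup bfin blim])
  show ?thesis
    by (rule that[of "\<lambda>n. F (\<phi> n)"]) (use F \<phi> r0 filterlim_compose[OF Flim \<phi>(1)] in auto)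
qed

section \<open>Passage to Lebesgue measurable sets\<close>

text \<open>The energies see a set only through integrals and its measure, so a Borel representative
  may replace it.\<close>

lemma J_hat_cong_AE:
  fixes E F :: "'a::euclidean_space set"
  assumes "AE x in lebesgue. x \<in> E \<longleftrightarrow> x \<in> F" "E \<in> sets lebesgue" "F \<in> sets lebesgue"
  shows "J_hat \<sigma> r E = J_hat \<sigma> r F"
proof -
  have J: "J_trunc \<sigma> s E = J_trunc \<sigma> s F" for s
  proof -
    have inner: "(\<integral>\<^sup>+y\<in>E - ball x s. ennreal (1 / norm (x - y) powr (real DIM('a) + \<sigma>)) \<partial>lebesgue) =
       (\<integral>\<^sup>+y\<in>F - ball x s. ennreal (1 / norm (x - y) powr (real DIM('a) + \<sigma>)) \<partial>lebesgue)" for x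
      by (rule nn_integral_cong_AE, use assms(1) in eventually_elim) (auto split: split_indicator)
    show ?thesis unfolding J_trunc_def inner
      by (intro arg_cong[where f="\<lambda>x. - enn2ereal x"] nn_integral_cong_AE, use assms(1) in eventually_elim)
        (auto split: split_indicator)
  qed
  have m: "measure lebesgue E = measure lebesgue F"
    by (rule measure_eq_AE[OF assms])
  have Jt: "J_hat_trunc \<sigma> s E = J_hat_trunc \<sigma> s F" for s by (simp add: J_hat_trunc_def J m)
  moreover have "J_hat_zero \<sigma> E = J_hat_zero \<sigma> F"
  proof (cases "\<sigma> < 0")
    case True
    then show ?thesis by (simp add: J_hat_zero_neg Jt)
  qed (simp add: J_hat_zero_def Jt)
  ultimately show ?thesis by (simp add: J_hat_def)
qed

lemma lmeasurable_borel_representative: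
  assumes "E \<in> lmeasurable"
  obtains F where "F \<in> sets borel" "emeasure lborel F < \<infinity>" "AE x in lebesgue. x \<in> E \<longleftrightarrow> x \<in> F"
proof -
  have E: "E \<in> sets lebesgue" "emeasure lebesgue E < \<infinity>" using assms by (auto simp: fmeasurable_def)
  from sets_completionE[OF E(1)] obtain S N N' where
    S: "E = S \<union> N" "N \<subseteq> N'" "N' \<in> null_sets lborel" "S \<in> sets lborel" by metis
  have "AE x in lebesgue. x \<notin> N'"
    using S(3) by (intro AE_not_in) (simp add: null_sets_completionI)
  then have "AE x in lebesgue. x \<in> E \<longleftrightarrow> x \<in> S"
    by eventually_elim (use S in auto)
  moreover have "emeasure lborel S < \<infinity>"
  proof -
    have "emeasure lborel S = emeasure lebesgue S" using S by simp
    also have "\<dots> \<le> emeasure lebesgue E" using S E by (intro emeasure_mono) auto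
    finally show ?thesis using E(2) by (rule le_less_trans)
  qed
  ultimately show ?thesis using that S by simp
qed

lemma integral_indicator_diff:
  fixes A B :: "'a::euclidean_space set"
  assumes "A \<in> lmeasurable" "B \<in> lmeasurable"
  shows "(\<integral>x. \<bar>indicat_real A x - indicat_real B x\<bar> \<partial>lebesgue) = measure lebesgue (sym_diff A B)"
proof -
  have "(\<integral>x. \<bar>indicat_real A x - indicat_real B x\<bar> \<partial>lebesgue) = (\<integral>x. indicat_real (sym_diff A B) x \<partial>lebesgue)"
    by (intro Bochner_Integration.integral_cong) (auto split: split_indicator)
  then show ?thesis using assms by simp
qed

theorem theorem6p5:
  fixes \<sigma>_bar r_bar :: real and \<sigma> r :: "nat \<Rightarrow> real"
  assumes "\<sigma>_bar \<in> {- real DIM('a::euclidean_space)<..<1}"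
    and "r_bar \<in> {0..}"
    and "\<And>n. \<sigma> n \<in> {- real DIM('a)<..<1}"
    and "\<And>n. r n \<in> {0..}"
    and "\<sigma> \<longlonglongrightarrow> \<sigma>_bar"
    and "r \<longlonglongrightarrow> r_bar"
  shows "(\<forall>(E :: 'a set) \<in> lmeasurable. \<forall>En :: nat \<Rightarrow> 'a set.
            (\<forall>n. En n \<in> lmeasurable) \<longrightarrow> indicator_L1_tendsto En E \<longrightarrow>
            J_hat \<sigma>_bar r_bar E \<le> liminf (\<lambda>n. J_hat (\<sigma> n) (r n) (En n)))
       \<and> (\<forall>(E :: 'a set) \<in> lmeasurable. \<exists>En :: nat \<Rightarrow> 'a set.
            (\<forall>n. En n \<in> lmeasurable) \<and> indicator_L1_tendsto En E \<and>
            J_hat \<sigma>_bar r_bar E \<ge> limsup (\<lambda>n. J_hat (\<sigma> n) (r n) (En n)))"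
proof (intro conjI ballI allI impI)
  have \<sigma>: "- real DIM('a) < \<sigma>_bar" "\<sigma>_bar < 1" "\<And>n. - real DIM('a) < \<sigma> n" and r: "0 \<le> r_bar" "\<And>n. 0 \<le> r n"
    using assms by auto
  {
    fix E :: "'a set" and En
    assume E: "E \<in> lmeasurable" and En: "\<forall>n. En n \<in> lmeasurable" and lim: "indicator_L1_tendsto En E"
    obtain F where F: "F \<in> sets borel" "emeasure lborel F < \<infinity>" "AE x in lebesgue. x \<in> E \<longleftrightarrow> x \<in> F"
      using lmeasurable_borel_representative[OF E] .
    have "\<exists>G. G \<in> sets borel \<and> emeasure lborel G < \<infinity> \<and> (AE x in lebesgue. x \<in> En n \<longleftrightarrow> x \<in> G)" for n
      using lmeasurable_borel_representative[of "En n"] En by metis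
    then obtain G where G: "\<And>n. G n \<in> sets borel" "\<And>n. emeasure lborel (G n) < \<infinity>"
       "\<And>n. AE x in lebesgue. x \<in> En n \<longleftrightarrow> x \<in> G n" by metis
    \<comment> \<open>The symmetric differences agree up to null sets, so the convergence in
      \<open>L1\<close> passes to the representatives.\<close>
    have "measure lborel (sym_diff (G n) F) = (\<integral>x. \<bar>indicat_real (En n) x - indicat_real E x\<bar> \<partial>lebesgue)" for n
    proof -
      have "AE x in lebesgue. x \<in> sym_diff (En n) E \<longleftrightarrow> x \<in> sym_diff (G n) F"
        using F(3) G(3)[of n] by eventually_elim auto
      moreover have "sym_diff (En n) E \<in> sets lebesgue" "sym_diff (G n) F \<in> sets lebesgue"
        using E En F G by auto
      ultimately have "measure lebesgue (sym_diff (En n) E) = measure lebesgue (sym_diff (G n) F)"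
        by (rule measure_eq_AE)
      then show ?thesis using F G E En by (simp add: integral_indicator_diff)
    qed
    then have "(\<lambda>n. measure lborel (sym_diff (G n) F)) \<longlonglongrightarrow> 0"
      using lim by (simp add: indicator_L1_tendsto_def)
    then have "J_hat \<sigma>_bar r_bar F \<le> liminf (\<lambda>n. J_hat (\<sigma> n) (r n) (G n))"
      by (intro J_hat_liminf F G assms \<sigma> r)
    moreover have "J_hat \<sigma>_bar r_bar E = J_hat \<sigma>_bar r_bar F"
      using E F by (intro J_hat_cong_AE) auto
    moreover have "J_hat (\<sigma> n) (r n) (En n) = J_hat (\<sigma> n) (r n) (G n)" for n
      using En G by (intro J_hat_cong_AE) auto
    ultimately show "J_hat \<sigma>_bar r_bar E \<le> liminf (\<lambda>n. J_hat (\<sigma> n) (r n) (En n))" by simp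
  next
    fix E :: "'a set" assume E: "E \<in> lmeasurable"
    obtain F where F: "F \<in> sets borel" "emeasure lborel F < \<infinity>" "AE x in lebesgue. x \<in> E \<longleftrightarrow> x \<in> F"
      using lmeasurable_borel_representative[OF E] .
    \<comment> \<open>A recovery sequence for the representative \<open>F\<close> serves
      \<open>E\<close> itself, with the same limit energy and the same \<open>L1\<close>
      distances.\<close>
    obtain En where En: "\<And>n. En n \<in> sets borel" "\<And>n. emeasure lborel (En n) < \<infinity>"
      "(\<lambda>n. measure lborel (sym_diff (En n) F)) \<longlonglongrightarrow> 0"
      "limsup (\<lambda>n. J_hat (\<sigma> n) (r n) (En n)) \<le> J_hat \<sigma>_bar r_bar F"
      by (rule J_hat_recovery_sequence[OF F(1,2) assms(5) \<sigma>(3,1,2) assms(6) r(2,1)]) blast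
    have Enl: "En n \<in> lmeasurable" for n using En by (auto intro!: fmeasurableI)
    have "measure lborel (sym_diff (En n) F) = (\<integral>x. \<bar>indicat_real (En n) x - indicat_real E x\<bar> \<partial>lebesgue)" for n
    proof -
      have "AE x in lebesgue. x \<in> sym_diff (En n) E \<longleftrightarrow> x \<in> sym_diff (En n) F"
        using F(3) by eventually_elim auto
      moreover have "sym_diff (En n) E \<in> sets lebesgue" "sym_diff (En n) F \<in> sets lebesgue"
        using E Enl[of n] En(1)[of n] F by auto
      ultimately have "measure lebesgue (sym_diff (En n) E) = measure lebesgue (sym_diff (En n) F)"
        by (rule measure_eq_AE)
      then show ?thesis using F E En Enl by (simp add: integral_indicator_diff)
    qed
    then have "indicator_L1_tendsto En E" using En(3) by (simp add: indicator_L1_tendsto_def)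
    moreover have "J_hat \<sigma>_bar r_bar E = J_hat \<sigma>_bar r_bar F"
      using E F by (intro J_hat_cong_AE) auto
    ultimately show "\<exists>En :: nat \<Rightarrow> 'a set.
            (\<forall>n. En n \<in> lmeasurable) \<and> indicator_L1_tendsto En E \<and>
            J_hat \<sigma>_bar r_bar E \<ge> limsup (\<lambda>n. J_hat (\<sigma> n) (r n) (En n))"
      using Enl En(4) by auto
  }
qed

end
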